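(* Let $d = d(n)$ satisfy $\sqrt{n}\,\log n \le d \le n/2$ with $nd$ even, and let $G$ be drawn from $\mathcal{G}_{n,d}$. Then, with probability $1 - o(1)$ as $n \to \infty$, $|\mathrm{aut}(B_1(G))| = 1$ and $|B_1(u) \cap B_1(v)| = (1 + o(1))\, d^2/n$ for every pair of vertices $u \ne v$. (That is, there is a deterministic sequence $\varepsilon_n \to 0$ such that with probability tending to $1$ one has both $|\mathrm{aut}(B_1(G))| = 1$ and $\bigl|\,|B_1(u)\cap B_1(v)| - d^2/n\,\bigr| \le \varepsilon_n d^2/n$ for all $u \neq v$.)
   Context: $\mathcal{G}_{n,d}$ is the uniform distribution over (simple, undirected) $d$-regular graphs on the vertex set $V = [n]$, where $nd$ is even. For a graph $G$ on $V$ with graph distance $d(\cdot,\cdot)$, $B_1(v) = \{u \in V : d(u,v) \le 1\}$ is the closed neighbourhood of $v$, and $B_1(G) = \{B_1(v) : v \in V\}$ is the set of all these balls. For a permutation $\sigma$ of $V$, $\sigma(G)$ is the graph on $V$ with edges $\{\sigma(u),\sigma(v)\}$ for edges $\{u,v\}$ of $G$. $\mathrm{aut}(B_1(G))$ is the set of permutations $\sigma$ of $V$ with $B_1(\sigma(G)) = B_1(G)$ (equality of sets of subsets of $V$). *)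

theory Defs
  imports
    "HOL-Probability.Probability"
    "HOL-Combinatorics.Permutations"
    "HOL-Library.Extended_Nat"
begin

(* A graph is given by its vertex set V and its set E of edges, each a two-element subset of V. *)

definition simple_graph :: "'a set \<Rightarrow> 'a set set \<Rightarrow> bool" where
  "simple_graph V E \<longleftrightarrow> (\<forall>e\<in>E. e \<subseteq> V \<and> card e = 2)"

definition degree :: "'a set set \<Rightarrow> 'a \<Rightarrow> nat" where
  "degree E v = card {e \<in> E. v \<in> e}"

definition regular_graphs :: "nat \<Rightarrow> nat \<Rightarrow> nat set set set" where
  "regular_graphs n d = {E. simple_graph {1..n} E \<and> (\<forall>v\<in>{1..n}. degree E v = d)}"

(* Meaningful only if a d-regular graph on {1..n} exists; otherwise the value of pmf_of_set is
   unspecified. *)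
definition random_regular_graph :: "nat \<Rightarrow> nat \<Rightarrow> nat set set pmf" where
  "random_regular_graph n d = pmf_of_set (regular_graphs n d)"

definition walk_between :: "'a set \<Rightarrow> 'a set set \<Rightarrow> 'a \<Rightarrow> 'a \<Rightarrow> 'a list \<Rightarrow> bool" where
  "walk_between V E u v xs \<longleftrightarrow>
     xs \<noteq> [] \<and> set xs \<subseteq> V \<and> successively (\<lambda>x y. {x, y} \<in> E) xs \<and> hd xs = u \<and> last xs = v"

(* The infimum over the empty set of walks is the top element of enat, so vertices in different
   components are at distance \<infinity>. *)
definition graph_dist :: "'a set \<Rightarrow> 'a set set \<Rightarrow> 'a \<Rightarrow> 'a \<Rightarrow> enat" where
  "graph_dist V E u v = (INF xs \<in> {xs. walk_between V E u v xs}. enat (length xs - 1))"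

definition ball1 :: "'a set \<Rightarrow> 'a set set \<Rightarrow> 'a \<Rightarrow> 'a set" where
  "ball1 V E v = {u \<in> V. graph_dist V E u v \<le> 1}"

definition balls1 :: "'a set \<Rightarrow> 'a set set \<Rightarrow> 'a set set" where
  "balls1 V E = ball1 V E ` V"

definition permute_graph :: "('a \<Rightarrow> 'a) \<Rightarrow> 'a set set \<Rightarrow> 'a set set" where
  "permute_graph \<sigma> E = (\<lambda>e. \<sigma> ` e) ` E"

definition aut_balls1 :: "'a set \<Rightarrow> 'a set set \<Rightarrow> ('a \<Rightarrow> 'a) set" where
  "aut_balls1 V E = {\<sigma>. \<sigma> permutes V \<and> balls1 V (permute_graph \<sigma> E) = balls1 V E}"

lemma graph_dist_le_1_iff:
  assumes "u \<in> V" "v \<in> V"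
  shows "graph_dist V E u v \<le> 1 \<longleftrightarrow> u = v \<or> {u, v} \<in> E"
proof
  let ?W = "{xs. walk_between V E u v xs}"
  assume le: "graph_dist V E u v \<le> 1"
  have "?W \<noteq> {}"
  proof
    assume "?W = {}"
    with le show False by (simp add: graph_dist_def top_enat_def)
  qed
  then have "graph_dist V E u v \<in> (\<lambda>xs. enat (length xs - 1)) ` ?W"
    unfolding graph_dist_def by (intro wellorder_InfI[where k = "enat (length (SOME xs. xs \<in> ?W) - 1)"])
      (use some_in_eq[of ?W] in blast)
  then obtain xs where xs: "walk_between V E u v xs" "enat (length xs - 1) \<le> 1"
    using le by auto
  then have "length xs \<le> 2" by (simp add: one_enat_def)
  with xs(1) show "u = v \<or> {u, v} \<in> E"
    unfolding walk_between_def
    by (cases xs; cases "tl xs") auto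
next
  assume "u = v \<or> {u, v} \<in> E"
  then have "\<exists>xs. walk_between V E u v xs \<and> length xs - 1 \<le> 1"
  proof
    assume "u = v"
    then show ?thesis using assms by (intro exI[of _ "[u]"]) (simp add: walk_between_def)
  next
    assume "{u, v} \<in> E"
    then show ?thesis using assms by (intro exI[of _ "[u, v]"]) (simp add: walk_between_def)
  qed
  then obtain xs where xs: "walk_between V E u v xs" "length xs - 1 \<le> 1" by blast
  then have "graph_dist V E u v \<le> enat (length xs - 1)"
    unfolding graph_dist_def by (intro INF_lower) simp
  also have "\<dots> \<le> 1" using xs(2) by (simp add: one_enat_def)
  finally show "graph_dist V E u v \<le> 1" .
qed

end

theory Submission
  imports Defs "HOL-Real_Asymp.Real_Asymp"
begin

text \<open>
  Everything rests on trades. Fix disjoint pairs of vertices \<open>(a, \<tau> a)\<close>, let \<open>W\<close> be the set of all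
  vertices in these pairs, and let \<open>S a\<close> be the symmetric difference of the two neighbourhoods
  outside \<open>W\<close>. Redistributing each \<open>S a\<close> between \<open>a\<close> and \<open>\<tau> a\<close>, with the same numbers of
  vertices, changes no degree. So, given all other data, the parts of \<open>S a\<close> adjacent to \<open>a\<close> are
  independent uniform subsets of prescribed size.

  Codegrees: for a single pair \<open>w, w'\<close> and a further vertex \<open>z\<close>, the difference of the codegrees
  of \<open>w\<close> and \<open>w'\<close> with \<open>z\<close> is the discrepancy of a uniform half of \<open>S\<close> on \<open>S \<inter> N z\<close>, and
  \<open>card (S \<inter> N z)\<close> is at most the sum of the two codegrees. So with high probability all codegrees
  with \<open>z\<close> are close to one another, hence to their average \<open>d (d - 1) / (n - 1)\<close>.

  Rigidity: an element \<open>\<sigma>\<close> of \<open>aut_balls1\<close> comes with an injection \<open>\<pi>\<close> such that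
  \<open>\<sigma> ` B v = B (\<pi> v)\<close>. If \<open>\<sigma>\<close> moves few vertices, then distinct balls are too different for \<open>\<pi>\<close> to
  move anything, and \<open>\<sigma>\<close> is the identity. Otherwise choose about \<open>d / 20\<close> moved vertices \<open>a\<close> with
  \<open>\<sigma> a \<notin> W\<close>: the symmetry then determines most of \<open>N a \<inter> S a\<close> from data that trades do not change,
  which has probability at most \<open>2 powr (- c d\<^sup>2)\<close>. As \<open>d\<^sup>2 \<ge> n (ln n)\<^sup>2\<close>, this beats the
  number \<open>exp (2 n ln n)\<close> of pairs \<open>(\<sigma>, \<pi>)\<close>.
\<close>

section \<open>Neighbourhood sets as a description of simple graphs\<close>

definition nbh :: "'a set set \<Rightarrow> 'a \<Rightarrow> 'a set" where
  "nbh E x = {y. {x, y} \<in> E}"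

definition regular_on :: "'a set \<Rightarrow> nat \<Rightarrow> 'a set set set" where
  "regular_on V d = {E. simple_graph V E \<and> (\<forall>v\<in>V. card (nbh E v) = d)}"

definition graph_of :: "('a \<Rightarrow> 'a set) \<Rightarrow> 'a set set" where
  "graph_of N = {{x, y} |x y. y \<in> N x}"

lemma nbh_sym: "y \<in> nbh E x \<longleftrightarrow> x \<in> nbh E y"
  by (simp add: nbh_def insert_commute)

lemma nbh_subset:
  assumes "simple_graph V E"
  shows "nbh E x \<subseteq> V"
  using assms by (auto simp: nbh_def simple_graph_def)

lemma nbh_irrefl:
  assumes "simple_graph V E"
  shows "x \<notin> nbh E x"
  using assms by (fastforce simp: nbh_def simple_graph_def)

lemma degree_eq_card_nbh:
  assumes "simple_graph V E"
  shows "degree E v = card (nbh E v)"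
proof -
  have "{e \<in> E. v \<in> e} = (\<lambda>y. {v, y}) ` nbh E v"
  proof (intro equalityI subsetI)
    fix e assume e: "e \<in> {e \<in> E. v \<in> e}"
    then have "card e = 2" using assms by (auto simp: simple_graph_def)
    then obtain y where "e = {v, y}" using e by (auto simp: card_2_iff)
    then show "e \<in> (\<lambda>y. {v, y}) ` nbh E v" using e by (auto simp: nbh_def)
  qed (auto simp: nbh_def)
  moreover have "inj_on (\<lambda>y. {v, y}) (nbh E v)"
    by (auto simp: inj_on_def doubleton_eq_iff)
  ultimately show ?thesis by (simp add: degree_def card_image)
qed

lemma regular_graphs_eq: "regular_graphs n d = regular_on {1..n} d"
  unfolding regular_graphs_def regular_on_def by (auto simp: degree_eq_card_nbh)

lemma simple_graph_eqI:
  assumes "simple_graph V E" "simple_graph V F" "\<And>x. nbh E x = nbh F x"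
  shows "E = F"
proof -
  have "e \<in> E \<longleftrightarrow> e \<in> F" for e
  proof -
    have "(\<exists>x y. e = {x, y})" if "e \<in> E \<or> e \<in> F"
      using that assms(1,2) unfolding simple_graph_def by (metis card_2_iff)
    then show ?thesis using assms(3) by (auto simp: nbh_def)
  qed
  then show ?thesis by blast
qed

lemma nbh_graph_of:
  assumes "\<And>x y. y \<in> N x \<Longrightarrow> x \<in> N y"
  shows "nbh (graph_of N) x = N x"
  using assms by (auto simp: nbh_def graph_of_def doubleton_eq_iff)

lemma simple_graph_of:
  assumes "\<And>x y. y \<in> N x \<Longrightarrow> x \<in> N y" "\<And>x. x \<notin> N x" "\<And>x. N x \<subseteq> V"
  shows "simple_graph V (graph_of N)"
  using assms unfolding simple_graph_def graph_of_def
  by (auto simp: card_2_iff doubleton_eq_iff) blast+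

lemma finite_regular_on:
  assumes "finite V"
  shows "finite (regular_on V d)"
  by (rule finite_subset[of _ "Pow (Pow V)"]) (use assms in \<open>auto simp: regular_on_def simple_graph_def\<close>)

lemma ball1_eq:
  assumes "simple_graph V E" "v \<in> V"
  shows "ball1 V E v = insert v (nbh E v)"
  using assms nbh_subset[OF assms(1), of v]
  by (auto simp: ball1_def graph_dist_le_1_iff nbh_def insert_commute)

subsection \<open>Trades\<close>

text \<open>The vertices of every pair are left out, not only \<open>a\<close> and
  \<open>\<tau> a\<close>: a trade then moves only edges with exactly one end in \<open>W\<close>,
  and trades at different pairs involve disjoint sets of edges.\<close>

definition trade_set :: "('a \<Rightarrow> 'a) \<Rightarrow> 'a set \<Rightarrow> 'a set set \<Rightarrow> 'a \<Rightarrow> 'a set" where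
  "trade_set \<tau> A E a = sym_diff (nbh E a) (nbh E (\<tau> a)) - (A \<union> \<tau> ` A)"

text \<open>The data that trades leave unchanged.\<close>

definition trade_key where
  "trade_key \<tau> A E = (let W = A \<union> \<tau> ` A in
     (\<lambda>x. {y \<in> nbh E x. x \<in> W \<longleftrightarrow> y \<in> W},
      restrict (\<lambda>a. ((nbh E a \<union> nbh E (\<tau> a)) - W, (nbh E a \<inter> nbh E (\<tau> a)) - W,
         card (nbh E a - W))) A))"

lemma trade_key_eq_iff:
  "trade_key \<tau> A E = trade_key \<tau> A F \<longleftrightarrow>
     (\<forall>x y. (x \<in> A \<union> \<tau> ` A \<longleftrightarrow> y \<in> A \<union> \<tau> ` A) \<longrightarrow> (y \<in> nbh E x \<longleftrightarrow> y \<in> nbh F x)) \<and>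
     (\<forall>a\<in>A. (nbh E a \<union> nbh E (\<tau> a)) - (A \<union> \<tau> ` A) = (nbh F a \<union> nbh F (\<tau> a)) - (A \<union> \<tau> ` A) \<and>
        (nbh E a \<inter> nbh E (\<tau> a)) - (A \<union> \<tau> ` A) = (nbh F a \<inter> nbh F (\<tau> a)) - (A \<union> \<tau> ` A) \<and>
        card (nbh E a - (A \<union> \<tau> ` A)) = card (nbh F a - (A \<union> \<tau> ` A)))"
proof -
  have "(\<lambda>x. {y \<in> nbh E x. x \<in> W \<longleftrightarrow> y \<in> W}) = (\<lambda>x. {y \<in> nbh F x. x \<in> W \<longleftrightarrow> y \<in> W}) \<longleftrightarrow>
    (\<forall>x y. (x \<in> W \<longleftrightarrow> y \<in> W) \<longrightarrow> (y \<in> nbh E x \<longleftrightarrow> y \<in> nbh F x))" for W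
    unfolding fun_eq_iff set_eq_iff by blast
  moreover have "restrict f A = restrict g A \<longleftrightarrow> (\<forall>a\<in>A. f a = g a)" for f g :: "'a \<Rightarrow> 'a set \<times> 'a set \<times> nat"
    unfolding restrict_def fun_eq_iff by auto
  ultimately show ?thesis
    unfolding trade_key_def Let_def by (simp only: prod.inject)
qed

lemma trade_set_key:
  assumes "trade_key \<tau> A E = trade_key \<tau> A F" "a \<in> A"
  shows "trade_set \<tau> A E a = trade_set \<tau> A F a"
proof -
  let ?W = "A \<union> \<tau> ` A"
  have "trade_set \<tau> A E a = ((nbh E a \<union> nbh E (\<tau> a)) - ?W) - ((nbh E a \<inter> nbh E (\<tau> a)) - ?W)" for E
    unfolding trade_set_def by blast
  then show ?thesis using assms unfolding trade_key_eq_iff by metis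
qed

text \<open>A pair contributes the number of its ends adjacent to \<open>x\<close>: one if
  \<open>x\<close> lies in the union of the two neighbourhoods, and one more if it lies in their
  intersection. For \<open>x\<close> outside \<open>W\<close> the trade key records both, and hence
  the number of neighbours of \<open>x\<close> in \<open>W\<close>.\<close>

lemma card_nbh_pairs:
  assumes "finite A" "inj_on \<tau> A" "A \<inter> \<tau> ` A = {}"
  shows "card (nbh E x \<inter> (A \<union> \<tau> ` A)) =
     card {a\<in>A. x \<in> nbh E a \<union> nbh E (\<tau> a)} + card {a\<in>A. x \<in> nbh E a \<inter> nbh E (\<tau> a)}"
proof -
  have "nbh E x \<inter> (A \<union> \<tau> ` A) = {a\<in>A. x \<in> nbh E a} \<union> \<tau> ` {a\<in>A. x \<in> nbh E (\<tau> a)}"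
    using nbh_sym by fast
  also have "card \<dots> = card {a\<in>A. x \<in> nbh E a} + card (\<tau> ` {a\<in>A. x \<in> nbh E (\<tau> a)})"
    by (rule card_Un_disjoint) (use assms in auto)
  also have "card (\<tau> ` {a\<in>A. x \<in> nbh E (\<tau> a)}) = card {a\<in>A. x \<in> nbh E (\<tau> a)}"
    by (rule card_image) (use assms in \<open>auto simp: inj_on_def\<close>)
  also have "card {a\<in>A. x \<in> nbh E a} + card {a\<in>A. x \<in> nbh E (\<tau> a)} =
     card ({a\<in>A. x \<in> nbh E a} \<union> {a\<in>A. x \<in> nbh E (\<tau> a)}) + card ({a\<in>A. x \<in> nbh E a} \<inter> {a\<in>A. x \<in> nbh E (\<tau> a)})"
    by (rule card_Un_Int) (use assms in auto)
  also have "{a\<in>A. x \<in> nbh E a} \<union> {a\<in>A. x \<in> nbh E (\<tau> a)} = {a\<in>A. x \<in> nbh E a \<union> nbh E (\<tau> a)}" by auto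
  also have "{a\<in>A. x \<in> nbh E a} \<inter> {a\<in>A. x \<in> nbh E (\<tau> a)} = {a\<in>A. x \<in> nbh E a \<inter> nbh E (\<tau> a)}" by auto
  finally show ?thesis .
qed

text \<open>Every degree is a function of the key: outside \<open>W\<close> by
  \<open>card_nbh_pairs\<close>; at \<open>a\<close> because the number of neighbours outside
  \<open>W\<close> is stored; at \<open>\<tau> a\<close> by inclusion-exclusion from the union, the
  intersection and the number for \<open>a\<close>.\<close>

lemma regular_on_trade_key:
  assumes V: "finite V" and A: "A \<subseteq> V" "\<tau> ` A \<subseteq> V" "inj_on \<tau> A" "A \<inter> \<tau> ` A = {}"
    and E: "E \<in> regular_on V d" and F: "simple_graph V F"
    and key: "trade_key \<tau> A E = trade_key \<tau> A F"
  shows "F \<in> regular_on V d"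
proof -
  define W where "W = A \<union> \<tau> ` A"
  have sE: "simple_graph V E" using E by (simp add: regular_on_def)
  have finA: "finite A" using V A finite_subset by blast
  have fin: "finite (nbh E x)" "finite (nbh F x)" for x
    using nbh_subset[OF sE] nbh_subset[OF F] V finite_subset by metis+
  have k1: "y \<in> nbh E x \<longleftrightarrow> y \<in> nbh F x" if "x \<in> W \<longleftrightarrow> y \<in> W" for x y
    using key that unfolding trade_key_eq_iff W_def by blast
  have k2: "(nbh E a \<union> nbh E (\<tau> a)) - W = (nbh F a \<union> nbh F (\<tau> a)) - W"
    "(nbh E a \<inter> nbh E (\<tau> a)) - W = (nbh F a \<inter> nbh F (\<tau> a)) - W"
    "card (nbh E a - W) = card (nbh F a - W)" if "a \<in> A" for a
    using key that unfolding trade_key_eq_iff W_def by blast+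
  have split: "card (nbh E x) = card (nbh E x - W) + card (nbh E x \<inter> W)"
     "card (nbh F x) = card (nbh F x - W) + card (nbh F x \<inter> W)" for x
    using fin card_Diff_subset_Int card_Int_Diff by (metis add.commute)+
  have sum: "card (nbh H a - W) + card (nbh H (\<tau> a) - W) =
     card ((nbh H a \<union> nbh H (\<tau> a)) - W) + card ((nbh H a \<inter> nbh H (\<tau> a)) - W)"
    if "finite (nbh H a)" "finite (nbh H (\<tau> a))" for a H
  proof -
    have "card (nbh H a - W) + card (nbh H (\<tau> a) - W) =
      card ((nbh H a - W) \<union> (nbh H (\<tau> a) - W)) + card ((nbh H a - W) \<inter> (nbh H (\<tau> a) - W))"
      by (rule card_Un_Int) (use that in auto)
    also have "(nbh H a - W) \<union> (nbh H (\<tau> a) - W) = (nbh H a \<union> nbh H (\<tau> a)) - W" by blast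
    also have "(nbh H a - W) \<inter> (nbh H (\<tau> a) - W) = (nbh H a \<inter> nbh H (\<tau> a)) - W" by blast
    finally show ?thesis .
  qed
  have "card (nbh E x) = card (nbh F x)" for x
  proof (cases "x \<in> W")
    case False
    have 1: "nbh E x - W = nbh F x - W" using k1 False by blast
    have *: "x \<in> nbh E a \<union> nbh E (\<tau> a) \<longleftrightarrow> x \<in> nbh F a \<union> nbh F (\<tau> a)"
         "x \<in> nbh E a \<inter> nbh E (\<tau> a) \<longleftrightarrow> x \<in> nbh F a \<inter> nbh F (\<tau> a)" if "a \<in> A" for a
      using k2[OF that] False by blast+
    have "{a\<in>A. x \<in> nbh E a \<union> nbh E (\<tau> a)} = {a\<in>A. x \<in> nbh F a \<union> nbh F (\<tau> a)}"
      "{a\<in>A. x \<in> nbh E a \<inter> nbh E (\<tau> a)} = {a\<in>A. x \<in> nbh F a \<inter> nbh F (\<tau> a)}"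
      using * by blast+
    then have "card (nbh E x \<inter> W) = card (nbh F x \<inter> W)"
      unfolding W_def card_nbh_pairs[OF finA A(3,4)] by simp
    with 1 split show ?thesis by simp
  next
    case True
    have 1: "nbh E x \<inter> W = nbh F x \<inter> W" using k1 True by blast
    have "card (nbh E x - W) = card (nbh F x - W)"
    proof (cases "x \<in> A")
      case True
      then show ?thesis using k2 by blast
    next
      case False
      then obtain a where a: "a \<in> A" "x = \<tau> a" using \<open>x \<in> W\<close> by (auto simp: W_def)
      show ?thesis using sum[of E a] sum[of F a] k2[OF a(1)] fin a(2) by simp
    qed
    with 1 split show ?thesis by simp
  qed
  then show ?thesis using E F by (simp add: regular_on_def)
qed

text \<open>Surgery on \<open>E\<close>: keep all edges inside \<open>W\<close> and all edges inside
  its complement. Outside \<open>W\<close>, join \<open>a\<close> to the common neighbours and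
  \<open>B a\<close>, and \<open>\<tau> a\<close> to the common neighbours and the rest of the trade
  set. The key is preserved, and regularity follows from
  \<open>regular_on_trade_key\<close>.\<close>

lemma trade_realise:
  assumes V: "finite V" and A: "A \<subseteq> V" "\<tau> ` A \<subseteq> V" "inj_on \<tau> A" "A \<inter> \<tau> ` A = {}"
    and E: "E \<in> regular_on V d"
    and B: "\<And>a. a \<in> A \<Longrightarrow> B a \<subseteq> trade_set \<tau> A E a"
      "\<And>a. a \<in> A \<Longrightarrow> card (B a) = card (nbh E a \<inter> trade_set \<tau> A E a)"
  shows "\<exists>F\<in>regular_on V d. trade_key \<tau> A E = trade_key \<tau> A F \<and>
           (\<forall>a\<in>A. nbh F a \<inter> trade_set \<tau> A F a = B a)"
proof -
  define W where "W = A \<union> \<tau> ` A"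
  define S where "S = trade_set \<tau> A E"
  \<comment> \<open>\<open>M w\<close> is the new neighbourhood of \<open>w\<close> outside
    \<open>W\<close>. The second branch concerns \<open>w = \<tau> a\<close>, with \<open>a\<close>
    recovered through the injectivity of \<open>\<tau>\<close>.\<close>
  define M where "M w = (if w \<in> A then ((nbh E w \<inter> nbh E (\<tau> w)) - W) \<union> B w
     else (let a = inv_into A \<tau> w in ((nbh E a \<inter> nbh E w) - W) \<union> (S a - B a)))" for w
  \<comment> \<open>For edges that cross the border of \<open>W\<close> the end in \<open>W\<close>
    decides, which makes \<open>N\<close> symmetric.\<close>
  define N where "N x = {y. if x \<in> W then (if y \<in> W then y \<in> nbh E x else y \<in> M x)
       else (if y \<in> W then x \<in> M y else y \<in> nbh E x)}" for x
  have sE: "simple_graph V E" using E by (simp add: regular_on_def)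
  note nV = nbh_subset[OF sE]
  have fin: "finite (nbh E x)" for x
    using nV V finite_subset by metis
  have MA: "M a = ((nbh E a \<inter> nbh E (\<tau> a)) - W) \<union> B a" if "a \<in> A" for a
    using that by (simp add: M_def)
  have MT: "M (\<tau> a) = ((nbh E a \<inter> nbh E (\<tau> a)) - W) \<union> (S a - B a)" if "a \<in> A" for a
    using that A by (auto simp: M_def Let_def)
  have S: "S a = sym_diff (nbh E a) (nbh E (\<tau> a)) - W" for a
    by (simp add: S_def trade_set_def W_def)
  have BS: "B a \<subseteq> S a" if "a \<in> A" for a using B that by (simp add: S_def)
  have Msub: "M w \<subseteq> V - W" if w: "w \<in> W" for w
  proof -
    obtain a where a: "a \<in> A" "w = a \<or> w = \<tau> a" using w by (auto simp: W_def)
    show ?thesis using a MA[OF a(1)] MT[OF a(1)] S[of a] BS[OF a(1)] nV[of a] nV[of "\<tau> a"] by blast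
  qed
  have WV: "W \<subseteq> V" using A by (auto simp: W_def)
  have sym: "x \<in> N y" if "y \<in> N x" for x y
    using that unfolding N_def using nbh_sym[of x E y] by (auto split: if_splits)
  have irr: "x \<notin> N x" for x using nbh_irrefl[OF sE] by (simp add: N_def)
  have sub: "N x \<subseteq> V" for x
    using Msub nV[of x] WV by (auto simp: N_def split: if_splits)
  define F where "F = graph_of N"
  have sF: "simple_graph V F" unfolding F_def by (rule simple_graph_of[OF sym irr sub])
  have nF: "nbh F x = N x" for x unfolding F_def by (rule nbh_graph_of[OF sym])
  have out: "nbh F w - W = M w" if "w \<in> W" for w
    using that Msub[OF that] by (auto simp: nF N_def)
  have outA: "nbh F a - W = ((nbh E a \<inter> nbh E (\<tau> a)) - W) \<union> B a" if "a \<in> A" for a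
    using that MA out[of a] by (auto simp: W_def)
  have outT: "nbh F (\<tau> a) - W = ((nbh E a \<inter> nbh E (\<tau> a)) - W) \<union> (S a - B a)" if "a \<in> A" for a
    using that MT out[of "\<tau> a"] by (auto simp: W_def)
  have key: "trade_key \<tau> A E = trade_key \<tau> A F"
    unfolding trade_key_eq_iff W_def[symmetric]
  proof (intro conjI allI impI ballI)
    fix x y assume "(x \<in> W) = (y \<in> W)"
    then show "(y \<in> nbh E x) = (y \<in> nbh F x)" by (auto simp: nF N_def)
  next
    fix a assume a: "a \<in> A"
    show "nbh E a \<union> nbh E (\<tau> a) - W = nbh F a \<union> nbh F (\<tau> a) - W"
      unfolding Un_Diff outA[OF a] outT[OF a] using BS[OF a] S[of a] by blast
    have "nbh F a \<inter> nbh F (\<tau> a) - W = (nbh F a - W) \<inter> (nbh F (\<tau> a) - W)" by blast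
    also have "\<dots> = nbh E a \<inter> nbh E (\<tau> a) - W"
      unfolding outA[OF a] outT[OF a] using BS[OF a] S[of a] by blast
    finally show "nbh E a \<inter> nbh E (\<tau> a) - W = nbh F a \<inter> nbh F (\<tau> a) - W" by simp
    have "nbh E a - W = ((nbh E a \<inter> nbh E (\<tau> a)) - W) \<union> (nbh E a \<inter> S a)" using S[of a] by blast
    also have "card \<dots> = card ((nbh E a \<inter> nbh E (\<tau> a)) - W) + card (nbh E a \<inter> S a)"
      by (rule card_Un_disjoint) (use fin S[of a] in auto)
    also have "card (nbh E a \<inter> S a) = card (B a)" using B(2)[OF a] by (simp add: S_def)
    also have "card ((nbh E a \<inter> nbh E (\<tau> a)) - W) + card (B a) = card (((nbh E a \<inter> nbh E (\<tau> a)) - W) \<union> B a)"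
    proof (rule card_Un_disjoint[symmetric])
      have "finite (S a)" unfolding S using fin by auto
      then show "finite (B a)" using BS[OF a] finite_subset by blast
    qed (use fin S[of a] BS[OF a] in auto)
    finally show "card (nbh E a - W) = card (nbh F a - W)" unfolding outA[OF a] .
  qed
  have "nbh F a \<inter> trade_set \<tau> A F a = B a" if a: "a \<in> A" for a
  proof -
    have "trade_set \<tau> A F a = S a" using trade_set_key[OF key a] by (simp add: S_def)
    moreover have "nbh F a \<inter> S a = (nbh F a - W) \<inter> S a" using S[of a] by blast
    ultimately show ?thesis unfolding outA[OF a] using BS[OF a] S[of a] by auto
  qed
  then show ?thesis using key regular_on_trade_key[OF V A E sF key] by blast
qed

text \<open>Edges that do not cross the border of \<open>W\<close> are in the key. Across the
  border, a vertex of the intersection is adjacent to both ends of a pair, a vertex outside the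
  union to neither, and on the trade set adjacency to \<open>a\<close> decides adjacency to
  \<open>\<tau> a\<close>.\<close>

lemma trade_inj:
  assumes A: "inj_on \<tau> A" "A \<inter> \<tau> ` A = {}"
    and E: "simple_graph V E" "simple_graph V F"
    and key: "trade_key \<tau> A E = trade_key \<tau> A F"
    and eq: "\<And>a. a \<in> A \<Longrightarrow> nbh E a \<inter> trade_set \<tau> A E a = nbh F a \<inter> trade_set \<tau> A F a"
  shows "E = F"
proof (rule simple_graph_eqI[OF E])
  define W where "W = A \<union> \<tau> ` A"
  have k1: "y \<in> nbh E x \<longleftrightarrow> y \<in> nbh F x" if "x \<in> W \<longleftrightarrow> y \<in> W" for x y
    using key that unfolding trade_key_eq_iff W_def by blast
  have k2: "(nbh E a \<union> nbh E (\<tau> a)) - W = (nbh F a \<union> nbh F (\<tau> a)) - W"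
    "(nbh E a \<inter> nbh E (\<tau> a)) - W = (nbh F a \<inter> nbh F (\<tau> a)) - W" if "a \<in> A" for a
    using key that unfolding trade_key_eq_iff W_def by blast+
  have *: "(y \<in> nbh E a \<longleftrightarrow> y \<in> nbh F a) \<and> (y \<in> nbh E (\<tau> a) \<longleftrightarrow> y \<in> nbh F (\<tau> a))"
    if "a \<in> A" "y \<notin> W" for a y
    using eq[OF that(1)] k2[OF that(1)] that(2) unfolding trade_set_def W_def[symmetric] by blast
  have **: "y \<in> nbh E w \<longleftrightarrow> y \<in> nbh F w" if "w \<in> W" "y \<notin> W" for w y
    using that(1) * that(2) unfolding W_def by blast
  show "nbh E x = nbh F x" for x
  proof (intro set_eqI)
    fix y
    show "y \<in> nbh E x \<longleftrightarrow> y \<in> nbh F x"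
      using k1[of x y] **[of x y] **[of y x] nbh_sym[of y E x] nbh_sym[of y F x] by argo
  qed
qed

text \<open>Injectivity is \<open>trade_inj\<close> and surjectivity is
  \<open>trade_realise\<close>. A uniform regular graph with a given key is thus a uniform point of
  a product, so its parts at different \<open>a\<close> are conditionally independent.\<close>

lemma trade_fibre_bij:
  assumes V: "finite V" and A: "A \<subseteq> V" "\<tau> ` A \<subseteq> V" "inj_on \<tau> A" "A \<inter> \<tau> ` A = {}"
    and E: "E \<in> regular_on V d"
  shows "bij_betw (\<lambda>F. \<lambda>a\<in>A. nbh F a \<inter> trade_set \<tau> A F a)
     {F \<in> regular_on V d. trade_key \<tau> A F = trade_key \<tau> A E}
     (\<Pi>\<^sub>E a\<in>A. {B. B \<subseteq> trade_set \<tau> A E a \<and> card B = card (nbh E a \<inter> trade_set \<tau> A E a)})"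
    (is "bij_betw ?f ?C ?P")
  unfolding bij_betw_def
proof (intro conjI equalityI subsetI)
  show "inj_on ?f ?C"
  proof (rule inj_onI)
    fix F G assume FG: "F \<in> ?C" "G \<in> ?C" "?f F = ?f G"
    show "F = G"
    proof (rule trade_inj[OF A(3,4), of V])
      fix a assume "a \<in> A"
      then show "nbh F a \<inter> trade_set \<tau> A F a = nbh G a \<inter> trade_set \<tau> A G a"
        using fun_cong[OF FG(3), of a] by simp
    next
      show "simple_graph V F" "simple_graph V G" using FG(1,2) unfolding regular_on_def by blast+
      show "trade_key \<tau> A F = trade_key \<tau> A G" using FG(1,2) by (simp only: mem_Collect_eq)
    qed
  qed
next
  fix B assume "B \<in> ?f ` ?C"
  then obtain F where F: "F \<in> regular_on V d" "trade_key \<tau> A F = trade_key \<tau> A E" "B = ?f F" by blast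
  have finF: "finite (nbh H x)" if "H \<in> regular_on V d" for H x
    using nbh_subset[of V H x] V finite_subset that by (auto simp: regular_on_def)
  have card: "card (nbh F a \<inter> trade_set \<tau> A F a) = card (nbh E a \<inter> trade_set \<tau> A E a)" if a: "a \<in> A" for a
  proof -
    define W where "W = A \<union> \<tau> ` A"
    \<comment> \<open>Both terms of the difference are determined by the key, so the size of the
      part at \<open>a\<close> is constant on the fibre.\<close>
    have *: "card (nbh H a \<inter> trade_set \<tau> A H a) = card (nbh H a - W) - card ((nbh H a \<inter> nbh H (\<tau> a)) - W)"
      if "H \<in> regular_on V d" for H
    proof -
      have "nbh H a \<inter> trade_set \<tau> A H a = (nbh H a - W) - ((nbh H a \<inter> nbh H (\<tau> a)) - W)"
        unfolding trade_set_def W_def by blast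
      moreover have "nbh H a \<inter> nbh H (\<tau> a) - W \<subseteq> nbh H a - W" by blast
      ultimately show ?thesis using finF[OF that, of a] by (metis card_Diff_subset finite_Diff finite_Int)
    qed
    have k2: "(nbh E a \<inter> nbh E (\<tau> a)) - W = (nbh F a \<inter> nbh F (\<tau> a)) - W"
      "card (nbh E a - W) = card (nbh F a - W)"
      using F(2)[symmetric] a unfolding trade_key_eq_iff W_def by blast+
    then show ?thesis using *[OF F(1)] *[OF E] by simp
  qed
  have "nbh F a \<inter> trade_set \<tau> A F a \<in> {B. B \<subseteq> trade_set \<tau> A E a \<and> card B = card (nbh E a \<inter> trade_set \<tau> A E a)}"
    if "a \<in> A" for a
    using card[OF that] unfolding mem_Collect_eq trade_set_key[OF F(2) that] by blast
  then show "B \<in> ?P" unfolding F(3) by (simp add: restrict_PiE_iff)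
next
  fix B assume B: "B \<in> ?P"
  have "\<exists>F\<in>regular_on V d. trade_key \<tau> A E = trade_key \<tau> A F \<and>
           (\<forall>a\<in>A. nbh F a \<inter> trade_set \<tau> A F a = B a)"
  proof (rule trade_realise[OF V A E])
    fix a assume "a \<in> A"
    then have "B a \<in> {B. B \<subseteq> trade_set \<tau> A E a \<and> card B = card (nbh E a \<inter> trade_set \<tau> A E a)}"
      by (rule PiE_mem[OF B])
    then show "B a \<subseteq> trade_set \<tau> A E a" "card (B a) = card (nbh E a \<inter> trade_set \<tau> A E a)"
      by simp_all
  qed
  then obtain F where F: "F \<in> regular_on V d" "trade_key \<tau> A E = trade_key \<tau> A F"
           "\<And>a. a\<in>A \<Longrightarrow> nbh F a \<inter> trade_set \<tau> A F a = B a" by blast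
  have "?f F = B"
  proof (rule extensionalityI[of _ A])
    show "B \<in> extensional A" using B by (simp only: PiE_def Int_iff)
  qed (use F(3) in simp_all)
  moreover have "F \<in> ?C" using F(1,2) by (simp only: mem_Collect_eq simp_thms)
  ultimately show "B \<in> ?f ` ?C" by (metis (no_types, lifting) imageI)
qed

text \<open>The law of total probability with respect to \<open>f\<close>. Fibres that miss
  \<open>X\<close> contribute nothing on the left, so the conditional bound is asked only at points
  of \<open>X\<close>.\<close>

lemma card_le_fibrewise:
  fixes p :: real
  assumes "finite R" "X \<subseteq> R" "p \<ge> 0"
    and "\<And>x. x \<in> X \<Longrightarrow> real (card {y\<in>X. f y = f x}) \<le> p * real (card {y\<in>R. f y = f x})"
  shows "real (card X) \<le> p * real (card R)"
proof -
  have *: "card Y = (\<Sum>k\<in>f ` R. card {y\<in>Y. f y = k})" if "Y \<subseteq> R" for Y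
  proof -
    have "Y = (\<Union>k\<in>f ` R. {y\<in>Y. f y = k})" using that by auto
    also have "card \<dots> = (\<Sum>k\<in>f ` R. card {y\<in>Y. f y = k})"
      by (rule card_UN_disjoint) (use assms(1) that finite_subset[OF that] in auto)
    finally show ?thesis .
  qed
  have "real (card {y\<in>X. f y = k}) \<le> p * real (card {y\<in>R. f y = k})" for k
  proof (cases "\<exists>x\<in>X. f x = k")
    case False
    then have "{y\<in>X. f y = k} = {}" by blast
    then show ?thesis using assms(3) by (simp only: card.empty) simp
  qed (use assms(4) in auto)
  then have "(\<Sum>k\<in>f ` R. real (card {y\<in>X. f y = k})) \<le> (\<Sum>k\<in>f ` R. p * real (card {y\<in>R. f y = k}))"
    by (intro sum_mono)
  then show ?thesis unfolding *[OF assms(2)] *[OF order_refl] by (simp add: sum_distrib_left)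
qed

text \<open>\<open>p\<close> bounds the conditional probability of the bad family at a single
  \<open>a\<close>, and the product structure of the fibres multiplies these bounds. The family may
  depend on a representative \<open>E\<close> of the fibre taken from \<open>X\<close>, so the
  properties that define \<open>X\<close> can be used to describe and to count it.\<close>

lemma trade_bound:
  fixes p :: real
  assumes V: "finite V" and A: "A \<subseteq> V" "\<tau> ` A \<subseteq> V" "inj_on \<tau> A" "A \<inter> \<tau> ` A = {}"
    and p: "p \<ge> 0" and X: "X \<subseteq> regular_on V d"
    and bad: "\<And>E F a. E \<in> X \<Longrightarrow> F \<in> X \<Longrightarrow> trade_key \<tau> A F = trade_key \<tau> A E \<Longrightarrow> a \<in> A \<Longrightarrow>
       nbh F a \<inter> trade_set \<tau> A E a \<in> \<B> E a"
    and dens: "\<And>E a. E \<in> X \<Longrightarrow> a \<in> A \<Longrightarrow>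
       real (card {B \<in> \<B> E a. B \<subseteq> trade_set \<tau> A E a \<and> card B = card (nbh E a \<inter> trade_set \<tau> A E a)})
       \<le> p * real (card (trade_set \<tau> A E a) choose card (nbh E a \<inter> trade_set \<tau> A E a))"
  shows "real (card X) \<le> p ^ card A * real (card (regular_on V d))"
proof (rule card_le_fibrewise[where f = "trade_key \<tau> A"])
  have finA: "finite A" using V A finite_subset by blast
  fix E assume EX: "E \<in> X"
  then have E: "E \<in> regular_on V d" using X by auto
  let ?S = "trade_set \<tau> A E" and ?c = "\<lambda>a. card (nbh E a \<inter> trade_set \<tau> A E a)"
  have finS: "finite (?S a)" for a
    using nbh_subset[of V E] E V by (intro finite_subset[OF _ V]) (auto simp: trade_set_def regular_on_def)
  note bij = trade_fibre_bij[OF V A E]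
  define P where "P = (\<Pi>\<^sub>E a\<in>A. {B. B \<subseteq> ?S a \<and> card B = ?c a})"
  define Q where "Q = (\<Pi>\<^sub>E a\<in>A. {B \<in> \<B> E a. B \<subseteq> ?S a \<and> card B = ?c a})"
  let ?f = "\<lambda>F. \<lambda>a\<in>A. nbh F a \<inter> trade_set \<tau> A F a"
  have cR: "card {F \<in> regular_on V d. trade_key \<tau> A F = trade_key \<tau> A E} = card P"
    unfolding P_def using bij_betw_same_card[OF bij] .
  also have "\<dots> = (\<Prod>a\<in>A. card (?S a) choose ?c a)"
    unfolding P_def using finA finS by (simp add: card_PiE n_subsets)
  finally have cR: "card {F \<in> regular_on V d. trade_key \<tau> A F = trade_key \<tau> A E} = (\<Prod>a\<in>A. card (?S a) choose ?c a)" .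
  have sub: "{F\<in>X. trade_key \<tau> A F = trade_key \<tau> A E} \<subseteq> {F \<in> regular_on V d. trade_key \<tau> A F = trade_key \<tau> A E}"
    using X by auto
  have "card {F\<in>X. trade_key \<tau> A F = trade_key \<tau> A E} \<le> card Q"
  proof (rule card_inj_on_le)
    show "inj_on ?f {F\<in>X. trade_key \<tau> A F = trade_key \<tau> A E}"
      by (rule inj_on_subset[OF bij_betw_imp_inj_on[OF bij] sub])
    show "finite Q" unfolding Q_def using finA finS by (intro finite_PiE) auto
    show "?f ` {F\<in>X. trade_key \<tau> A F = trade_key \<tau> A E} \<subseteq> Q"
    proof
      fix B assume "B \<in> ?f ` {F\<in>X. trade_key \<tau> A F = trade_key \<tau> A E}"
      then obtain F where F: "F \<in> X" "trade_key \<tau> A F = trade_key \<tau> A E" "B = ?f F" by blast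
      have "F \<in> {F \<in> regular_on V d. trade_key \<tau> A F = trade_key \<tau> A E}"
        using F(1,2) X by blast
      from bij_betwE[OF bij, rule_format, OF this] have P: "?f F \<in> P" unfolding P_def .
      have "?f F a \<in> {B \<in> \<B> E a. B \<subseteq> ?S a \<and> card B = ?c a}" if a: "a \<in> A" for a
      proof -
        have "?f F a = nbh F a \<inter> ?S a" using a trade_set_key[OF F(2) a] by simp
        then show ?thesis using bad[OF EX F(1,2) a] PiE_mem[OF P[unfolded P_def] a] by simp
      qed
      then show "B \<in> Q" unfolding F(3) Q_def by (simp add: restrict_PiE_iff)
    qed
  qed
  then have "real (card {F\<in>X. trade_key \<tau> A F = trade_key \<tau> A E}) \<le> real (card Q)" by simp
  also have "\<dots> = (\<Prod>a\<in>A. real (card {B \<in> \<B> E a. B \<subseteq> ?S a \<and> card B = ?c a}))"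
    unfolding Q_def using finA by (simp add: card_PiE)
  also have "\<dots> \<le> (\<Prod>a\<in>A. p * real (card (?S a) choose ?c a))"
    by (intro prod_mono conjI dens EX) auto
  also have "\<dots> = p ^ card A * real (card {F \<in> regular_on V d. trade_key \<tau> A F = trade_key \<tau> A E})"
    unfolding cR by (simp add: prod.distrib)
  finally show "real (card {F\<in>X. trade_key \<tau> A F = trade_key \<tau> A E}) \<le>
     p ^ card A * real (card {F \<in> regular_on V d. trade_key \<tau> A F = trade_key \<tau> A E})" .
qed (use X p finite_regular_on[OF V] in auto)

subsection \<open>Codegrees\<close>

text \<open>The bounds \<open>1 + x + x\<^sup>2\<close> for \<open>exp x\<close> and
  \<open>1 - x + x\<^sup>2\<close> for \<open>exp (- x)\<close> add up with cancelling linear terms.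
  This controls the exponential moment of a random sign.\<close>

lemma exp_plus_exp_minus_le:
  fixes x :: real
  assumes "0 \<le> x" "x \<le> 1"
  shows "exp x + exp (- x) \<le> 2 * exp (x\<^sup>2)"
proof -
  have "exp (- x) = inverse (exp x)" by (rule exp_minus)
  also have "\<dots> \<le> inverse (1 + x)"
    using assms exp_ge_add_one_self[of x] by (intro le_imp_inverse_le) auto
  also have "inverse (1 + x) \<le> 1 - x + x\<^sup>2"
  proof -
    have "(1 - x + x\<^sup>2) * (1 + x) = 1 + x ^ 3" by (simp add: algebra_simps power2_eq_square power3_eq_cube)
    then have "1 \<le> (1 - x + x\<^sup>2) * (1 + x)" using assms by simp
    then show ?thesis using assms by (simp add: field_simps)
  qed
  finally have "exp x + exp (- x) \<le> 2 * (1 + x\<^sup>2)"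
    using exp_bound[OF assms] by simp
  also have "\<dots> \<le> 2 * exp (x\<^sup>2)" by (rule mult_left_mono[OF exp_ge_add_one_self]) simp
  finally show ?thesis .
qed

text \<open>For a uniform subset of \<open>S\<close> the discrepancy is a sum of independent signs
  over \<open>Q\<close>, so the exponential moment factorises over the elements. Elements outside
  \<open>Q\<close> contribute the factor 2 only.\<close>

lemma sum_exp_discrepancy_le:
  fixes x :: real
  assumes "finite S" "Q \<subseteq> S" "0 \<le> x" "x \<le> 1"
  shows "(\<Sum>B\<in>Pow S. exp (x * (real (card (B \<inter> Q)) - real (card (Q - B))))) \<le> 2 ^ card S * exp (x\<^sup>2 * card Q)"
proof -
  \<comment> \<open>\<open>f y\<close> is the weight of \<open>y\<close> if it lies in
    \<open>B\<close>, and \<open>g y\<close> if it does not; \<open>prod_add\<close> performs the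
    sum over all \<open>B\<close>.\<close>
  define f where "f y = (if y \<in> Q then exp x else 1)" for y
  define g where "g y = (if y \<in> Q then exp (- x) else 1)" for y
  have "exp (x * (real (card (B \<inter> Q)) - real (card (Q - B)))) = prod f B * prod g (S - B)"
    if "B \<in> Pow S" for B
  proof -
    have fB: "finite B" using that assms(1) finite_subset by auto
    have "prod f B = (\<Prod>y\<in>B \<inter> Q. exp x)"
      unfolding f_def using fB by (simp add: prod.If_cases)
    moreover have "prod g (S - B) = (\<Prod>y\<in>(S - B) \<inter> Q. exp (- x))"
      unfolding g_def using assms(1) by (simp add: prod.If_cases)
    moreover have "(S - B) \<inter> Q = Q - B" using assms(2) by blast
    ultimately show ?thesis
      by (simp add: exp_of_nat_mult[symmetric] exp_add[symmetric] algebra_simps)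
  qed
  then have "(\<Sum>B\<in>Pow S. exp (x * (real (card (B \<inter> Q)) - real (card (Q - B))))) = (\<Prod>y\<in>S. f y + g y)"
    using prod_add[OF assms(1), of f g] by simp
  also have "\<dots> \<le> (\<Prod>y\<in>S. 2 * (if y \<in> Q then exp (x\<^sup>2) else 1))"
    by (rule prod_mono) (use exp_plus_exp_minus_le[OF assms(3,4)] in \<open>auto simp: f_def g_def add_nonneg_nonneg\<close>)
  also have "\<dots> = 2 ^ card S * exp (x\<^sup>2) ^ card Q"
    using assms(1,2) by (simp add: prod.distrib prod.If_cases Int_absorb1)
  also have "exp (x\<^sup>2) ^ card Q = exp (x\<^sup>2 * card Q)"
    by (simp add: exp_of_nat_mult[symmetric] mult.commute)
  finally show ?thesis .
qed

text \<open>Chernoff's bound for a subset of \<open>S\<close> of any size. A uniform subset of size \<open>card S / 2\<close> costs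
  only a further factor linear in \<open>card S\<close>, by the lower bound for the central binomial coefficient.\<close>

lemma card_discrepancy_le:
  fixes x t :: real
  assumes "finite S" "Q \<subseteq> S" "0 \<le> x" "x \<le> 1"
  shows "real (card {B. B \<subseteq> S \<and> x\<^sup>2 * card Q + t < x * (real (card (B \<inter> Q)) - real (card (Q - B)))})
     \<le> 2 ^ card S * exp (- t)"
proof -
  let ?X = "{B. B \<subseteq> S \<and> x\<^sup>2 * card Q + t < x * (real (card (B \<inter> Q)) - real (card (Q - B)))}"
  have "real (card ?X) * exp (x\<^sup>2 * card Q + t) = (\<Sum>B\<in>?X. exp (x\<^sup>2 * card Q + t))" by simp
  also have "\<dots> \<le> (\<Sum>B\<in>?X. exp (x * (real (card (B \<inter> Q)) - real (card (Q - B)))))"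
    by (rule sum_mono) auto
  also have "\<dots> \<le> (\<Sum>B\<in>Pow S. exp (x * (real (card (B \<inter> Q)) - real (card (Q - B)))))"
    by (rule sum_mono2) (use assms in auto)
  also have "\<dots> \<le> 2 ^ card S * exp (x\<^sup>2 * card Q)"
    by (rule sum_exp_discrepancy_le[OF assms])
  finally show ?thesis by (simp add: exp_add exp_minus field_simps)
qed

text \<open>Equal degrees give both private neighbourhoods the same size, and leaving out
  \<open>w\<close> and \<open>w'\<close> takes one vertex from each if they are adjacent and none
  otherwise. A trade therefore chooses exactly half of the trade set, which brings in the central
  binomial coefficient.\<close>

lemma card_trade_set_single:
  assumes V: "finite V" and E: "E \<in> regular_on V d" and w: "w \<in> V" "w' \<in> V" "w \<noteq> w'"
  shows "card (trade_set (\<lambda>_. w') {w} E w) = 2 * card (nbh E w \<inter> trade_set (\<lambda>_. w') {w} E w)"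
proof -
  have sE: "simple_graph V E" and c: "card (nbh E w) = card (nbh E w')"
    using E w by (auto simp: regular_on_def)
  have fin: "finite (nbh E x)" for x using nbh_subset[OF sE] V finite_subset by metis
  let ?S = "trade_set (\<lambda>_. w') {w} E w"
  let ?L = "nbh E w - nbh E w'" and ?R = "nbh E w' - nbh E w"
  have irr: "w \<notin> nbh E w" "w' \<notin> nbh E w'" using nbh_irrefl[OF sE] by auto
  have LR: "card ?L = card ?R"
    using c fin by (metis card_Diff_subset_Int finite_Int inf_commute)
  have eq: "card (?L - {w, w'}) = card (?R - {w, w'})"
  proof (cases "w' \<in> nbh E w")
    case True
    then have "w \<in> nbh E w'" using nbh_sym by metis
    then have "?L - {w, w'} = ?L - {w'}" "?R - {w, w'} = ?R - {w}" "w' \<in> ?L" "w \<in> ?R"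
      using irr True by auto
    then show ?thesis using LR fin by (metis card_Diff_singleton)
  next
    case False
    then have "w \<notin> nbh E w'" using nbh_sym by metis
    then have "?L - {w, w'} = ?L" "?R - {w, w'} = ?R" using irr False by auto
    then show ?thesis using LR by simp
  qed
  have 1: "nbh E w \<inter> ?S = ?L - {w, w'}" by (auto simp: trade_set_def)
  have "?S = (?L - {w, w'}) \<union> (?R - {w, w'})" by (auto simp: trade_set_def)
  also have "card \<dots> = card (?L - {w, w'}) + card (?R - {w, w'})"
    by (rule card_Un_disjoint) (use fin in auto)
  finally have "card ?S = card (?L - {w, w'}) + card (?R - {w, w'})" .
  with 1 eq show ?thesis by simp
qed

text \<open>Common neighbours of \<open>w\<close>, \<open>w'\<close> and \<open>z\<close> cancel in
  the difference of the codegrees, which leaves the discrepancy of the traded part on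
  \<open>?Q\<close>. As \<open>?Q\<close> is no larger than the sum of the codegrees, the event
  forces a large discrepancy. The factor \<open>2 * real n\<close> pays for passing from all subsets
  to those of half the size.\<close>

lemma codegree_trade_bound:
  fixes x t :: real
  assumes V: "finite V" "card V = n"
    and w: "w \<in> V" "w' \<in> V" "w \<noteq> w'" "z \<noteq> w" "z \<noteq> w'" and x: "0 \<le> x" "x \<le> 1"
  shows "real (card {E \<in> regular_on V d.
      x\<^sup>2 * (real (card (nbh E w \<inter> nbh E z)) + real (card (nbh E w' \<inter> nbh E z))) + t
       < x * (real (card (nbh E w \<inter> nbh E z)) - real (card (nbh E w' \<inter> nbh E z)) - 1)})
     \<le> 2 * real n * exp (- t) * real (card (regular_on V d))"
    (is "real (card ?X) \<le> _")
proof -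
  let ?S = "\<lambda>E. trade_set (\<lambda>_. w') {w} E w"
  let ?Q = "\<lambda>E. ?S E \<inter> nbh E z"
  define \<B> :: "'a set set \<Rightarrow> 'a \<Rightarrow> 'a set set"
    where "\<B> E a = {B. x\<^sup>2 * card (?Q E) + t < x * (real (card (B \<inter> ?Q E)) - real (card (?Q E - B)))}" for E a
  have n: "n \<ge> 1" using V w by (metis One_nat_def Suc_leI card_gt_0_iff empty_iff)
  have "real (card ?X) \<le> (2 * real n * exp (- t)) ^ card {w} * real (card (regular_on V d))"
  proof (rule trade_bound[where \<tau> = "\<lambda>_. w'" and \<B> = \<B>])
    fix E F a
    assume EF: "E \<in> ?X" "F \<in> ?X" "trade_key (\<lambda>_. w') {w} F = trade_key (\<lambda>_. w') {w} E" "a \<in> {w}"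
    have sF: "simple_graph V F" using EF(2) by (simp add: regular_on_def)
    have fin: "finite (nbh F x)" for x using nbh_subset[OF sF] V finite_subset by metis
    have S: "?S F = ?S E" using trade_set_key[OF EF(3)] by simp
    \<comment> \<open>Neither \<open>z\<close> nor a vertex of the trade set is \<open>w\<close> or
      \<open>w'\<close>, so the key records whether they are adjacent.\<close>
    have Q: "?Q E = ?Q F"
    proof -
      have "y \<in> nbh E z \<longleftrightarrow> y \<in> nbh F z" if "y \<in> ?S E" for y
        using EF(3) that w unfolding trade_key_eq_iff by (auto simp: trade_set_def)
      then show ?thesis unfolding S by blast
    qed
    define B where "B = nbh F w \<inter> ?S F"
    define Q' where "Q' = ?Q F"
    have fQ: "finite Q'" using fin by (simp add: Q'_def)
    define C where "C = nbh F w \<inter> nbh F w' \<inter> nbh F z"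
    \<comment> \<open>The vertex \<open>w'\<close> may be a common neighbour of \<open>w\<close> and
      \<open>z\<close> although it is outside the trade set. The summand \<open>- 1\<close> in the
      event accounts for it.\<close>
    have "nbh F w \<inter> nbh F z \<subseteq> insert w' (C \<union> (B \<inter> Q'))"
      using nbh_irrefl[OF sF] by (auto simp: B_def Q'_def C_def trade_set_def)
    then have "card (nbh F w \<inter> nbh F z) \<le> card (insert w' (C \<union> (B \<inter> Q')))"
      by (rule card_mono[rotated]) (use fin fQ in \<open>auto simp: C_def\<close>)
    also have "\<dots> \<le> Suc (card (C \<union> (B \<inter> Q')))" by (rule card_insert_le_m1) auto
    also have "\<dots> \<le> Suc (card C + card (B \<inter> Q'))" using card_Un_le by auto
    finally have 1: "card (nbh F w \<inter> nbh F z) \<le> Suc (card C + card (B \<inter> Q'))" .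
    have "card C + card (Q' - B) = card (C \<union> (Q' - B))"
      by (rule card_Un_disjoint[symmetric]) (use fin fQ in \<open>auto simp: C_def Q'_def trade_set_def\<close>)
    also have "\<dots> \<le> card (nbh F w' \<inter> nbh F z)"
      by (rule card_mono) (use fin in \<open>auto simp: C_def Q'_def B_def trade_set_def\<close>)
    finally have 2: "card C + card (Q' - B) \<le> card (nbh F w' \<inter> nbh F z)" .
    have "card Q' = card (Q' \<inter> B) + card (Q' - B)"
      using card_Int_Diff[OF fQ] .
    also have "card (Q' \<inter> B) \<le> card (nbh F w \<inter> nbh F z)"
      by (rule card_mono) (use fin in \<open>auto simp: Q'_def B_def\<close>)
    also have "card (Q' - B) \<le> card (nbh F w' \<inter> nbh F z)" using 2 by simp
    finally have 3: "real (card Q') \<le> real (card (nbh F w \<inter> nbh F z)) + real (card (nbh F w' \<inter> nbh F z))"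
      by simp
    have "x\<^sup>2 * card Q' + t \<le> x\<^sup>2 * (real (card (nbh F w \<inter> nbh F z)) + real (card (nbh F w' \<inter> nbh F z))) + t"
      using 3 by (intro add_right_mono mult_left_mono) auto
    also have "\<dots> < x * (real (card (nbh F w \<inter> nbh F z)) - real (card (nbh F w' \<inter> nbh F z)) - 1)"
      using EF(2) by simp
    also have "\<dots> \<le> x * (real (card (B \<inter> Q')) - real (card (Q' - B)))"
      using 1 2 x by (intro mult_left_mono) auto
    finally have "B \<in> \<B> E w"
      unfolding \<B>_def mem_Collect_eq Q Q'_def .
    then show "nbh F a \<inter> trade_set (\<lambda>_. w') {w} E a \<in> \<B> E a"
      using EF(4) unfolding B_def S by simp
  next
    fix E a assume E: "E \<in> ?X" "a \<in> {w}"
    then have ER: "E \<in> regular_on V d" by simp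
    define c where "c = card (nbh E w \<inter> ?S E)"
    have sub: "nbh E w \<inter> ?S E \<subseteq> V" "?S E \<subseteq> V"
      using nbh_subset[of V E] ER by (auto simp: regular_on_def trade_set_def)
    have finS: "finite (?S E)" using sub(2) V(1) by (rule finite_subset)
    have cn: "c \<le> n" unfolding c_def V(2)[symmetric] by (rule card_mono[OF V(1) sub(1)])
    have cS: "card (?S E) = 2 * c" unfolding c_def by (rule card_trade_set_single[OF V(1) ER w(1-3)])
    have "card {B \<in> \<B> E w. B \<subseteq> ?S E \<and> card B = c} \<le>
      card {B. B \<subseteq> ?S E \<and> x\<^sup>2 * card (?Q E) + t < x * (real (card (B \<inter> ?Q E)) - real (card (?Q E - B)))}"
      by (rule card_mono) (use finS in \<open>auto simp: \<B>_def\<close>)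
    also have "real \<dots> \<le> 2 ^ card (?S E) * exp (- t)"
      by (rule card_discrepancy_le[OF finS _ x]) simp
    also have "2 ^ card (?S E) = (4::real) ^ c" unfolding cS by (simp add: power_mult)
    also have "(4::real) ^ c \<le> 2 * real n * real (2 * c choose c)"
    proof (cases "c = 0")
      case False
      then have "4 ^ c \<le> 2 * real c * real (2 * c choose c)"
        using central_binomial_lower_bound[of c] by (simp add: field_simps)
      also have "\<dots> \<le> 2 * real n * real (2 * c choose c)"
        using cn by (intro mult_right_mono) auto
      finally show ?thesis .
    qed (use n in simp)
    finally have "real (card {B \<in> \<B> E w. B \<subseteq> ?S E \<and> card B = c}) \<le> 2 * real n * exp (- t) * real (2 * c choose c)"
      by (simp add: mult_right_mono mult_ac)
    then show "real (card {B \<in> \<B> E a. B \<subseteq> trade_set (\<lambda>_. w') {w} E a \<and>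
                     card B = card (nbh E a \<inter> trade_set (\<lambda>_. w') {w} E a)})
         \<le> 2 * real n * exp (- t) * real (card (trade_set (\<lambda>_. w') {w} E a) choose
              card (nbh E a \<inter> trade_set (\<lambda>_. w') {w} E a))"
      using E(2) cS by (simp add: c_def)
  qed (use V w in auto)
  then show ?thesis by simp
qed

text \<open>Double counting of walks of length two from \<open>z\<close> that do not return to
  \<open>z\<close>: each of the \<open>d\<close> neighbours of \<open>z\<close> has
  \<open>d - 1\<close> neighbours other than \<open>z\<close>.\<close>

lemma sum_codegrees:
  assumes V: "finite V" and E: "E \<in> regular_on V d" and z: "z \<in> V"
  shows "(\<Sum>w\<in>V - {z}. card (nbh E w \<inter> nbh E z)) = d * (d - 1)"
proof -
  have sE: "simple_graph V E" using E by (simp add: regular_on_def)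
  note nV = nbh_subset[OF sE]
  have fin: "finite (nbh E x)" for x using nV V finite_subset by metis
  have "(\<Sum>w\<in>V - {z}. card (nbh E w \<inter> nbh E z)) = (\<Sum>w\<in>V - {z}. \<Sum>y\<in>nbh E z. if y \<in> nbh E w then 1 else 0)"
    using fin by (simp add: sum.If_cases Int_commute)
  also have "\<dots> = (\<Sum>y\<in>nbh E z. \<Sum>w\<in>V - {z}. if y \<in> nbh E w then 1 else 0)"
    by (rule sum.swap)
  also have "\<dots> = (\<Sum>y\<in>nbh E z. d - 1)"
  proof (rule sum.cong[OF refl])
    fix y assume y: "y \<in> nbh E z"
    have "(V - {z}) \<inter> {w. y \<in> nbh E w} = nbh E y - {z}"
      using nV[of y] nbh_sym[of y E] by blast
    moreover have "z \<in> nbh E y" "y \<in> V" using y nV nbh_sym by fast+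
    ultimately show "(\<Sum>w\<in>V - {z}. if y \<in> nbh E w then 1 else 0) = d - 1"
      using V E by (simp add: sum.If_cases regular_on_def)
  qed
  also have "\<dots> = d * (d - 1)" using E z by (simp add: regular_on_def)
  finally show ?thesis .
qed

text \<open>Summing the comparison between \<open>w\<close> and \<open>u\<close> over all
  \<open>u\<close> other than \<open>z\<close> replaces the codegree of \<open>u\<close> by the
  average \<open>d (d - 1) / (n - 1)\<close> known from \<open>sum_codegrees\<close>.\<close>

lemma codegree_estimate:
  fixes x s :: real
  assumes V: "finite V" "card V = n" "n \<ge> 2" and E: "E \<in> regular_on V d" and x: "0 \<le> x" "s \<ge> 0"
    and close: "\<And>w w' z. w \<in> V \<Longrightarrow> w' \<in> V \<Longrightarrow> z \<in> V \<Longrightarrow> w \<noteq> w' \<Longrightarrow> z \<noteq> w \<Longrightarrow> z \<noteq> w' \<Longrightarrow>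
       real (card (nbh E w \<inter> nbh E z)) - real (card (nbh E w' \<inter> nbh E z))
        \<le> x * (real (card (nbh E w \<inter> nbh E z)) + real (card (nbh E w' \<inter> nbh E z))) + s"
    and w: "w \<in> V" "z \<in> V" "w \<noteq> z"
  shows "(1 - x) * real (card (nbh E w \<inter> nbh E z)) \<le> (1 + x) * (real (d * (d - 1)) / (real n - 1)) + s"
    "(1 - x) * (real (d * (d - 1)) / (real n - 1)) - s \<le> (1 + x) * real (card (nbh E w \<inter> nbh E z))"
proof -
  define X where "X u = real (card (nbh E u \<inter> nbh E z))" for u
  have sumX: "(\<Sum>u\<in>V - {z}. X u) = real (d * (d - 1))"
    unfolding X_def of_nat_sum[symmetric] sum_codegrees[OF V(1) E w(2)] ..
  have X0: "X u \<ge> 0" for u by (simp add: X_def)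
  have cV: "real (card (V - {z})) = real n - 1" using V w by (simp add: of_nat_diff)
  \<comment> \<open>The trivial case \<open>u = w\<close> is included so that the sums run over all
    of \<open>V - {z}\<close>.\<close>
  have 1: "(1 - x) * X w - s \<le> (1 + x) * X u" and 2: "(1 - x) * X u \<le> (1 + x) * X w + s"
    if "u \<in> V - {z}" for u
  proof -
    have z: "z \<noteq> u" "z \<noteq> w" using that w by auto
    show "(1 - x) * X w - s \<le> (1 + x) * X u"
    proof (cases "u = w")
      case True
      then show ?thesis using x X0[of w] mult_nonneg_nonneg[OF x(1) X0[of w]] by (simp add: algebra_simps)
    next
      case False
      then show ?thesis using close[of w u z] that w z by (simp add: X_def algebra_simps)
    qed
    show "(1 - x) * X u \<le> (1 + x) * X w + s"
    proof (cases "u = w")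
      case True
      then show ?thesis using x X0[of w] mult_nonneg_nonneg[OF x(1) X0[of w]] by (simp add: algebra_simps)
    next
      case False
      then show ?thesis using close[of u w z] that w z by (simp add: X_def algebra_simps)
    qed
  qed
  have n: "real n - 1 > 0" using V by simp
  have "(\<Sum>u\<in>V - {z}. (1 - x) * X w - s) \<le> (\<Sum>u\<in>V - {z}. (1 + x) * X u)"
    by (rule sum_mono) (rule 1)
  then have "(real n - 1) * ((1 - x) * X w - s) \<le> (1 + x) * real (d * (d - 1))"
    unfolding sum_distrib_left[symmetric] sumX by (simp add: cV)
  then show "(1 - x) * real (card (nbh E w \<inter> nbh E z)) \<le> (1 + x) * (real (d * (d - 1)) / (real n - 1)) + s"
    using n unfolding X_def by (simp add: field_simps)
  have "(\<Sum>u\<in>V - {z}. (1 - x) * X u) \<le> (\<Sum>u\<in>V - {z}. (1 + x) * X w + s)"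
    by (rule sum_mono) (rule 2)
  then have "(1 - x) * real (d * (d - 1)) \<le> (real n - 1) * ((1 + x) * X w + s)"
    unfolding sum_distrib_left[symmetric] sumX by (simp add: cV)
  then show "(1 - x) * (real (d * (d - 1)) / (real n - 1)) - s \<le> (1 + x) * real (card (nbh E w \<inter> nbh E z))"
    using n unfolding X_def by (simp add: field_simps)
qed

subsection \<open>Symmetries of the set of balls\<close>

text \<open>Pascal's rule splits the coefficient into two that satisfy the hypotheses with
  \<open>k\<close> lowered by one. The bound serves to show that a trade set admits many
  redistributions.\<close>

lemma two_power_le_binomial:
  assumes "k \<le> c" "c + k \<le> s"
  shows "2 ^ k \<le> s choose c"
  using assms
proof (induction k arbitrary: s c)
  case 0
  then show ?case by (simp add: Suc_leI)
next
  case (Suc k)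
  obtain s' c' where s: "s = Suc s'" "c = Suc c'" using Suc.prems by (cases s; cases c) auto
  have "2 ^ k \<le> s' choose c'" "2 ^ k \<le> s' choose c" using Suc.prems s by (auto intro!: Suc.IH)
  then show ?case by (simp add: s)
qed

text \<open>Greedy choice: each chosen element \<open>a\<close> rules out at most three candidates,
  namely \<open>a\<close>, \<open>f a\<close> and the preimage of \<open>a\<close>.\<close>

lemma disjoint_from_image_subset:
  assumes f: "finite V" "inj_on f V" "f ` V \<subseteq> V" and m: "3 * m \<le> card {x \<in> V. f x \<noteq> x}"
  shows "\<exists>A\<subseteq>V. card A = m \<and> A \<inter> f ` A = {}"
  using m
proof (induction m)
  case (Suc m)
  then obtain A where A: "A \<subseteq> V" "card A = m" "A \<inter> f ` A = {}" by auto
  have fA: "finite A" using A f finite_subset by blast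
  define P where "P = {x\<in>V. f x \<in> A}"
  have "card P \<le> card A"
    by (rule card_inj_on_le[where f = f]) (use f fA in \<open>auto simp: P_def inj_on_def\<close>)
  then have "card (A \<union> f ` A \<union> P) \<le> m + m + m"
    using card_Un_le[of "A \<union> f ` A" P] card_Un_le[of A "f ` A"] card_image_le[OF fA, of f] A(2) by linarith
  then have "\<not> {x \<in> V. f x \<noteq> x} \<subseteq> A \<union> f ` A \<union> P"
    using Suc.prems card_mono[of "A \<union> f ` A \<union> P" "{x \<in> V. f x \<noteq> x}"] fA f(1) by (auto simp: P_def)
  then obtain x where x: "x \<in> V" "f x \<noteq> x" "x \<notin> A" "x \<notin> f ` A" "x \<notin> P" by blast
  have "insert x A \<inter> f ` insert x A = {}" using x A by (auto simp: P_def)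
  moreover have "card (insert x A) = Suc m" using x A fA by simp
  moreover have "insert x A \<subseteq> V" using A x by simp
  ultimately show ?case by (intro exI[of _ "insert x A"] conjI)
qed (simp add: exI[of _ "{}"])

text \<open>With \<open>\<sigma>\<close> and \<open>\<pi>\<close> both fixed, the symmetry becomes a
  condition on single adjacencies, which suits a union bound. The codegree condition keeps trade
  sets large; its ratio 3/5 leaves room above 1/2, the value of \<open>(d\<^sup>2 / n) / d\<close>
  at \<open>d = n / 2\<close>.\<close>

definition symmetry_graphs where
  "symmetry_graphs V d \<sigma> \<pi> = {E \<in> regular_on V d.
     (\<forall>x\<in>V. \<forall>v\<in>V. x \<in> insert v (nbh E v) \<longleftrightarrow> \<sigma> x \<in> insert (\<pi> v) (nbh E (\<pi> v))) \<and>
     (\<forall>u\<in>V. \<forall>v\<in>V. u \<noteq> v \<longrightarrow> 5 * card (nbh E u \<inter> nbh E v) \<le> 3 * d)}"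

text \<open>A vertex \<open>v\<close> of the trade set is adjacent to \<open>a\<close> exactly when
  \<open>\<sigma> a\<close> equals or is adjacent to \<open>\<pi> v\<close>, and the key decides
  this if \<open>\<sigma> a\<close> and \<open>\<pi> v\<close> both lie outside \<open>W\<close>. At
  most \<open>2 * m\<close> vertices \<open>v\<close> have \<open>\<pi> v\<close> in
  \<open>W\<close>, so at most \<open>2 ^ (2 * m)\<close> of at least \<open>2 ^ (6 * m)\<close>
  redistributions survive at each of the \<open>m\<close> vertices of \<open>A\<close>.\<close>

lemma symmetry_bound:
  assumes V: "finite V" and \<sigma>: "\<sigma> permutes V" and \<pi>: "inj_on \<pi> V" "\<pi> ` V \<subseteq> V"
    and m: "20 * m \<le> d" "3 * m \<le> card {x \<in> V. \<sigma> x \<noteq> x}"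
  shows "real (card (symmetry_graphs V d \<sigma> \<pi>)) \<le> (1/2) ^ (4 * m * m) * real (card (regular_on V d))"
proof -
  have \<sigma>V: "\<sigma> ` V \<subseteq> V" "inj_on \<sigma> V" "inj \<sigma>"
    using permutes_image[OF \<sigma>] permutes_inj[OF \<sigma>] inj_on_subset[OF permutes_inj[OF \<sigma>] subset_UNIV]
    by (simp_all only: order_refl)
  obtain A where A: "A \<subseteq> V" "card A = m" "A \<inter> \<sigma> ` A = {}"
    using disjoint_from_image_subset[OF V \<sigma>V(2,1) m(2)] by blast
  have fA: "finite A" using A V finite_subset by blast
  have "card (A \<union> \<sigma> ` A) \<le> 2 * m"
    using card_Un_le[of A "\<sigma> ` A"] card_image_le[OF fA, of \<sigma>] A by linarith
  moreover have "3 * m \<le> card V" using m(2) card_mono[OF V, of "{x \<in> V. \<sigma> x \<noteq> x}"] by auto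
  moreover have "card (V - (A \<union> \<sigma> ` A)) = card V - card (A \<union> \<sigma> ` A)"
    by (rule card_Diff_subset) (use fA A \<sigma>V in auto)
  ultimately have "card A \<le> card (V - (A \<union> \<sigma> ` A))" using A by simp
  \<comment> \<open>The partners also avoid the image of \<open>A\<close> under
    \<open>\<sigma>\<close>, so that \<open>\<sigma> a\<close> lies outside
    \<open>W\<close>.\<close>
  then obtain \<tau> where \<tau>: "\<tau> ` A \<subseteq> V - (A \<union> \<sigma> ` A)" "inj_on \<tau> A"
    using card_le_inj[of A "V - (A \<union> \<sigma> ` A)"] fA V by auto
  define W where "W = A \<union> \<tau> ` A"
  have \<sigma>W: "\<sigma> a \<notin> W" if "a \<in> A" for a
    using A(3) \<tau>(1) that by (auto simp: W_def)
  have cW: "card W \<le> 2 * m" and fW: "finite W"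
    using card_Un_le[of A "\<tau> ` A"] card_image_le[OF fA, of \<tau>] A fA by (auto simp: W_def)
  let ?X = "symmetry_graphs V d \<sigma> \<pi>"
  \<comment> \<open>On \<open>R E a\<close> the adjacency to \<open>a\<close> is forced: graphs of
    \<open>?X\<close> with the same key agree there.\<close>
  define R where "R E a = trade_set \<tau> A E a - {v. \<pi> v \<in> W}" for E a
  define \<B> where "\<B> E a = {B. B \<inter> R E a = nbh E a \<inter> R E a}" for E a
  have XR: "?X \<subseteq> regular_on V d" by (auto simp: symmetry_graphs_def)
  have "real (card ?X) \<le> ((1/2) ^ (4 * m)) ^ card A * real (card (regular_on V d))"
  proof (rule trade_bound[where \<tau> = \<tau> and \<B> = \<B>])
    fix E F a
    assume EF: "E \<in> ?X" "F \<in> ?X" "trade_key \<tau> A F = trade_key \<tau> A E" "a \<in> A"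
    have "v \<in> nbh F a \<longleftrightarrow> v \<in> nbh E a" if v: "v \<in> R E a" for v
    proof -
      have sub: "nbh E x \<subseteq> V" for x using nbh_subset[of V E] EF(1) XR by (auto simp: regular_on_def)
      have vV: "v \<in> V" "v \<notin> W" "\<pi> v \<notin> W" "a \<in> V" "a \<noteq> v"
        using v sub EF(4) A(1) by (auto simp: R_def trade_set_def W_def)
      have *: "v \<in> nbh H a \<longleftrightarrow> \<sigma> a = \<pi> v \<or> \<sigma> a \<in> nbh H (\<pi> v)" if H: "H \<in> ?X" for H
      proof -
        have "v \<in> nbh H a \<longleftrightarrow> a \<in> insert v (nbh H v)"
          using vV(5) nbh_sym[of v H a] by simp
        also have "\<dots> \<longleftrightarrow> \<sigma> a \<in> insert (\<pi> v) (nbh H (\<pi> v))"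
          using H vV(1,4) unfolding symmetry_graphs_def by blast
        finally show ?thesis by simp
      qed
      have "\<sigma> a \<in> nbh F (\<pi> v) \<longleftrightarrow> \<sigma> a \<in> nbh E (\<pi> v)"
        using EF(3) \<sigma>W[OF EF(4)] vV(3) unfolding trade_key_eq_iff W_def by blast
      then show ?thesis using *[OF EF(1)] *[OF EF(2)] by simp
    qed
    then show "nbh F a \<inter> trade_set \<tau> A E a \<in> \<B> E a"
      by (auto simp: \<B>_def R_def)
  next
    fix E a assume E: "E \<in> ?X" and a: "a \<in> A"
    have ER: "E \<in> regular_on V d" using E XR by blast
    have sub: "nbh E x \<subseteq> V" for x using nbh_subset[of V E] ER by (auto simp: regular_on_def)
    have fin: "finite (nbh E x)" for x using sub V finite_subset by metis
    define S where "S = trade_set \<tau> A E a"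
    have SV: "S \<subseteq> V" using sub by (auto simp: S_def trade_set_def)
    have finS: "finite S" by (rule finite_subset[OF SV V])
    define c where "c = card (nbh E a \<inter> S)"
    have in_V: "a \<in> V" "\<tau> a \<in> V" "a \<noteq> \<tau> a" using a A \<tau> by auto
    \<comment> \<open>The codegree condition leaves at least \<open>2 * d / 5 \<ge> 8 * m\<close>
      vertices, and \<open>W\<close> removes at most \<open>2 * m\<close> of them.\<close>
    have ge: "6 * m \<le> card (nbh E u - nbh E v - W)" if "u \<in> V" "v \<in> V" "u \<noteq> v" for u v
    proof -
      have "card (nbh E u) = d" using ER that by (simp add: regular_on_def)
      moreover have "5 * card (nbh E u \<inter> nbh E v) \<le> 3 * d"
        using E that by (simp add: symmetry_graphs_def)
      moreover have "card (nbh E u) = card (nbh E u \<inter> nbh E v) + card (nbh E u - nbh E v)"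
        by (rule card_Int_Diff[OF fin])
      moreover have "card (nbh E u - nbh E v) - card W \<le> card (nbh E u - nbh E v - W)"
        by (rule diff_card_le_card_Diff[OF fW])
      ultimately show ?thesis using m(1) cW by linarith
    qed
    have S: "S = (nbh E a - nbh E (\<tau> a) - W) \<union> (nbh E (\<tau> a) - nbh E a - W)"
      unfolding S_def trade_set_def W_def by blast
    have c: "c = card (nbh E a - nbh E (\<tau> a) - W)"
      unfolding c_def by (rule arg_cong[where f = card]) (auto simp: S)
    have cS: "card S = c + card (nbh E (\<tau> a) - nbh E a - W)"
      unfolding c S by (rule card_Un_disjoint) (use fin in auto)
    have big: "2 ^ (6 * m) \<le> card S choose c"
      by (rule two_power_le_binomial) (use ge[OF in_V] ge[OF in_V(2,1) in_V(3)[symmetric]] c cS in auto)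
    have "card {B \<in> \<B> E a. B \<subseteq> S \<and> card B = c} \<le> card (Pow (S - R E a))"
    proof (rule card_inj_on_le[where f = "\<lambda>B. B - R E a"])
      show "inj_on (\<lambda>B. B - R E a) {B \<in> \<B> E a. B \<subseteq> S \<and> card B = c}"
      proof (rule inj_onI)
        fix B C assume "B \<in> {B \<in> \<B> E a. B \<subseteq> S \<and> card B = c}" "C \<in> {B \<in> \<B> E a. B \<subseteq> S \<and> card B = c}"
          "B - R E a = C - R E a"
        then have "B \<inter> R E a = C \<inter> R E a" "B - R E a = C - R E a" by (auto simp: \<B>_def)
        then show "B = C" by blast
      qed
    qed (use finS in auto)
    also have "\<dots> = 2 ^ card (S - R E a)" using finS by (simp add: card_Pow)
    also have "card (S - R E a) \<le> 2 * m"
    proof -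
      have "card (S - R E a) \<le> card W"
        by (rule card_inj_on_le[where f = \<pi>])
           (use fW \<pi> SV in \<open>auto simp: R_def S_def[symmetric] intro: inj_on_subset\<close>)
      then show ?thesis using cW by simp
    qed
    finally have "card {B \<in> \<B> E a. B \<subseteq> S \<and> card B = c} \<le> 2 ^ (2 * m)" by simp
    then have "real (card {B \<in> \<B> E a. B \<subseteq> S \<and> card B = c}) \<le> 2 ^ (2 * m)"
      by (metis of_nat_le_iff of_nat_numeral of_nat_power)
    also have "\<dots> = (1/2) ^ (4 * m) * 2 ^ (6 * m)"
    proof -
      have "(2::real) ^ (6 * m) = 2 ^ (4 * m) * 2 ^ (2 * m)" by (simp add: power_add[symmetric])
      then show ?thesis by (simp add: power_one_over)
    qed
    also have "\<dots> \<le> (1/2) ^ (4 * m) * real (card S choose c)"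
    proof (rule mult_left_mono)
      show "(2::real) ^ (6 * m) \<le> real (card S choose c)"
        using big by (metis of_nat_le_iff of_nat_numeral of_nat_power)
    qed simp
    finally show "real (card {B \<in> \<B> E a. B \<subseteq> trade_set \<tau> A E a \<and>
                     card B = card (nbh E a \<inter> trade_set \<tau> A E a)})
         \<le> (1/2) ^ (4 * m) * real (card (trade_set \<tau> A E a) choose card (nbh E a \<inter> trade_set \<tau> A E a))"
      unfolding S_def c_def .
  qed (use V A \<tau> XR in auto)
  then show ?thesis by (simp add: A(2) power_mult[symmetric])
qed

section \<open>From automorphisms of the family of balls to pairs of a permutation and an
  injection\<close>

lemma nbh_permute_graph:
  assumes "inj \<sigma>"
  shows "nbh (permute_graph \<sigma> E) (\<sigma> x) = \<sigma> ` nbh E x"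
proof -
  have "{\<sigma> x, y} \<in> permute_graph \<sigma> E \<longleftrightarrow> (\<exists>z. y = \<sigma> z \<and> {x, z} \<in> E)" for y
  proof
    assume "{\<sigma> x, y} \<in> permute_graph \<sigma> E"
    then obtain e where e: "e \<in> E" "{\<sigma> x, y} = \<sigma> ` e" by (auto simp: permute_graph_def)
    have "y \<in> \<sigma> ` e" using e(2) by blast
    then obtain z where z: "y = \<sigma> z" by blast
    have "\<sigma> ` {x, z} = \<sigma> ` e" using e(2) z by simp
    then have "e = {x, z}" using assms by (metis inj_image_eq_iff)
    then show "\<exists>z. y = \<sigma> z \<and> {x, z} \<in> E" using z e by blast
  next
    assume "\<exists>z. y = \<sigma> z \<and> {x, z} \<in> E"
    then obtain z where "y = \<sigma> z" "{x, z} \<in> E" by blast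
    then have "{\<sigma> x, y} = \<sigma> ` {x, z}" by simp
    then show "{\<sigma> x, y} \<in> permute_graph \<sigma> E" using \<open>{x, z} \<in> E\<close> unfolding permute_graph_def by blast
  qed
  then show ?thesis by (auto simp: nbh_def)
qed

lemma balls1_permute_graph:
  assumes \<sigma>: "\<sigma> permutes V" and E: "simple_graph V E"
  shows "balls1 V (permute_graph \<sigma> E) = (\<lambda>v. \<sigma> ` insert v (nbh E v)) ` V"
proof -
  have inj: "inj \<sigma>" using \<sigma> by (rule permutes_inj)
  have s: "simple_graph V (permute_graph \<sigma> E)"
    using E permutes_image[OF \<sigma>] inj unfolding simple_graph_def permute_graph_def
    by (auto simp: card_image inj_on_subset)
  have "nbh (permute_graph \<sigma> E) (\<sigma> v) = \<sigma> ` nbh E v" for v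
    by (rule nbh_permute_graph[OF inj])
  then have "ball1 V (permute_graph \<sigma> E) (\<sigma> v) = \<sigma> ` insert v (nbh E v)" if "v \<in> V" for v
    using ball1_eq[OF s, of "\<sigma> v"] permutes_in_image[OF \<sigma>] that by simp
  moreover have "balls1 V (permute_graph \<sigma> E) = (\<lambda>v. ball1 V (permute_graph \<sigma> E) (\<sigma> v)) ` V"
    unfolding balls1_def using permutes_image[OF \<sigma>] by (metis image_image)
  ultimately show ?thesis by (metis (no_types, lifting) image_cong)
qed

lemma balls1_eq:
  assumes "simple_graph V E"
  shows "balls1 V E = (\<lambda>v. insert v (nbh E v)) ` V"
  unfolding balls1_def by (rule image_cong) (simp_all add: ball1_eq[OF assms])

lemma id_in_aut_balls1: "id \<in> aut_balls1 V E"
  by (simp add: aut_balls1_def permutes_id permute_graph_def)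

text \<open>Distinct balls share so few vertices that balls determine their centres, which makes
  \<open>\<pi>\<close> injective. If \<open>\<sigma>\<close> moved fewer than \<open>3 * m\<close>
  vertices, the balls of \<open>v\<close> and \<open>\<pi> v\<close> would differ too little to be
  distinct; so \<open>\<pi>\<close> would fix every vertex, and then \<open>x\<close> and
  \<open>\<sigma> x\<close> would have the same ball.\<close>

lemma nontrivial_aut_balls1:
  assumes V: "finite V" and E: "E \<in> regular_on V d"
    and good: "\<And>u v. u \<in> V \<Longrightarrow> v \<in> V \<Longrightarrow> u \<noteq> v \<Longrightarrow>
       5 * card (insert u (nbh E u) \<inter> insert v (nbh E v)) \<le> 3 * d"
    and \<sigma>: "\<sigma> \<in> aut_balls1 V E" "\<sigma> \<noteq> id" and m: "20 * m \<le> d"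
  shows "3 * m \<le> card {x \<in> V. \<sigma> x \<noteq> x}"
    and "\<exists>\<pi>\<in>V \<rightarrow>\<^sub>E V. inj_on \<pi> V \<and> E \<in> symmetry_graphs V d \<sigma> \<pi>"
proof -
  have sE: "simple_graph V E" using E by (simp add: regular_on_def)
  have per: "\<sigma> permutes V" using \<sigma> by (simp add: aut_balls1_def)
  have inj: "inj \<sigma>" using per by (rule permutes_inj)
  define b where "b v = insert v (nbh E v)" for v
  have fin: "finite (nbh E x)" for x using nbh_subset[OF sE] V finite_subset by metis
  have fb: "finite (b v)" for v using fin by (simp add: b_def)
  have cb: "card (b v) = Suc d" if "v \<in> V" for v
    using that E fin nbh_irrefl[OF sE] by (simp add: b_def regular_on_def)
  have good: "5 * card (b u \<inter> b v) \<le> 3 * d" if "u \<in> V" "v \<in> V" "u \<noteq> v" for u v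
    using good that by (simp add: b_def)
  have bdist: "u = v" if "u \<in> V" "v \<in> V" "b u = b v" for u v
  proof (rule ccontr)
    assume "u \<noteq> v"
    then show False using good[OF that(1,2)] that cb[of v] by simp
  qed
  have "(\<lambda>v. \<sigma> ` b v) ` V = b ` V"
    using \<sigma> balls1_permute_graph[OF per sE] balls1_eq[OF sE] unfolding aut_balls1_def b_def by simp
  then have "\<forall>v\<in>V. \<exists>u\<in>V. \<sigma> ` b v = b u" by blast
  then obtain p where p: "\<And>v. v \<in> V \<Longrightarrow> p v \<in> V \<and> \<sigma> ` b v = b (p v)" by metis
  have bV: "b v \<subseteq> V" if "v \<in> V" for v using that nbh_subset[OF sE] by (auto simp: b_def)
  \<comment> \<open>Restriction to \<open>V\<close> makes \<open>\<pi>\<close> one of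
    \<open>n ^ n\<close> extensional functions, as the union bound requires.\<close>
  define \<pi> where "\<pi> = restrict p V"
  have pV: "\<pi> \<in> V \<rightarrow>\<^sub>E V" using p by (auto simp: \<pi>_def)
  have ip: "inj_on \<pi> V"
  proof (rule inj_onI)
    fix u v assume uv: "u \<in> V" "v \<in> V" "\<pi> u = \<pi> v"
    then have "\<sigma> ` b u = \<sigma> ` b v" using p by (simp add: \<pi>_def)
    then have "b u = b v" using inj by (simp add: inj_image_eq_iff)
    then show "u = v" using bdist uv by blast
  qed
  have eq: "x \<in> b v \<longleftrightarrow> \<sigma> x \<in> b (\<pi> v)" if "v \<in> V" for x v
    using p[OF that] inj that by (metis \<pi>_def inj_image_mem_iff restrict_apply)
  have "5 * card (nbh E u \<inter> nbh E v) \<le> 3 * d" if "u \<in> V" "v \<in> V" "u \<noteq> v" for u v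
  proof -
    have "card (nbh E u \<inter> nbh E v) \<le> card (b u \<inter> b v)"
      by (rule card_mono) (use fb in \<open>auto simp: b_def\<close>)
    then show ?thesis using good[OF that] by linarith
  qed
  then have "E \<in> symmetry_graphs V d \<sigma> \<pi>"
    using E eq unfolding symmetry_graphs_def b_def by blast
  then show "\<exists>\<pi>\<in>V \<rightarrow>\<^sub>E V. inj_on \<pi> V \<and> E \<in> symmetry_graphs V d \<sigma> \<pi>" using pV ip by blast
  show "3 * m \<le> card {x \<in> V. \<sigma> x \<noteq> x}"
  proof (rule ccontr)
    assume "\<not> ?thesis"
    then have small: "card {x \<in> V. \<sigma> x \<noteq> x} < 3 * m" by simp
    have p_id: "\<pi> v = v" if v: "v \<in> V" for v
    proof (rule ccontr)
      assume ne: "\<pi> v \<noteq> v"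
      have pv: "\<pi> v \<in> V" using v pV by auto
      \<comment> \<open>A fixed point of \<open>\<sigma>\<close> in \<open>b v\<close> also lies in
        the image \<open>b (\<pi> v)\<close>. The difference has more than
        \<open>2 * d / 5 \<ge> 8 * m\<close> elements, too many for the set of moved
        vertices.\<close>
      have "b v - b (\<pi> v) \<subseteq> {x \<in> V. \<sigma> x \<noteq> x}" using eq[OF v] bV[OF v] by auto
      then have "card (b v - b (\<pi> v)) \<le> card {x \<in> V. \<sigma> x \<noteq> x}"
        using V by (intro card_mono) auto
      moreover have "card (b v) = card (b v \<inter> b (\<pi> v)) + card (b v - b (\<pi> v))"
        by (rule card_Int_Diff[OF fb])
      ultimately show False using good[OF v pv] ne cb[OF v] small m by auto
    qed
    obtain x where x: "\<sigma> x \<noteq> x" using \<sigma>(2) by (auto simp: fun_eq_iff)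
    then have xV: "x \<in> V" using per by (metis permutes_not_in)
    then have sxV: "\<sigma> x \<in> V" using permutes_in_image[OF per] by simp
    \<comment> \<open>Since \<open>\<pi> v = v\<close>, the permutation maps \<open>b v\<close> onto
      itself; exchanging point and centre gives the claim.\<close>
    have "v \<in> b x \<longleftrightarrow> v \<in> b (\<sigma> x)" for v
    proof (cases "v \<in> V")
      case True
      have "v \<in> b x \<longleftrightarrow> x \<in> b v" for x unfolding b_def using nbh_sym[of v E x] by auto
      then show ?thesis using eq[OF True, of x] p_id[OF True] by simp
    next
      case False
      then show ?thesis using bV xV sxV by blast
    qed
    then have "b x = b (\<sigma> x)" by blast
    then show False using bdist[OF xV sxV] x by simp
  qed
qed

text \<open>A union bound over \<open>\<sigma>\<close> and \<open>\<pi>\<close>: there are at most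
  \<open>fact n \<le> n ^ n\<close> permutations and at most \<open>n ^ n\<close>
  injections.\<close>

lemma nontrivial_symmetry_bound:
  assumes V: "finite V" "card V = n" and m: "20 * m \<le> d"
  shows "real (card {E \<in> regular_on V d. card (aut_balls1 V E) \<noteq> 1 \<and>
      (\<forall>u\<in>V. \<forall>v\<in>V. u \<noteq> v \<longrightarrow> 5 * card (insert u (nbh E u) \<inter> insert v (nbh E v)) \<le> 3 * d)})
    \<le> real n ^ n * real n ^ n * (1/2) ^ (4 * m * m) * real (card (regular_on V d))"
    (is "real (card ?X) \<le> _")
proof -
  define P where "P = {\<sigma>. \<sigma> permutes V \<and> 3 * m \<le> card {x \<in> V. \<sigma> x \<noteq> x}} \<times> {\<pi> \<in> V \<rightarrow>\<^sub>E V. inj_on \<pi> V}"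
  have "finite ({\<sigma>. \<sigma> permutes V} \<times> (V \<rightarrow>\<^sub>E V))"
    using V(1) by (auto intro: finite_permutations finite_PiE)
  moreover have PS: "P \<subseteq> {\<sigma>. \<sigma> permutes V} \<times> (V \<rightarrow>\<^sub>E V)" by (auto simp: P_def)
  ultimately have fP: "finite P" and "card P \<le> card ({\<sigma>. \<sigma> permutes V} \<times> (V \<rightarrow>\<^sub>E V))"
    by (auto intro: finite_subset card_mono)
  note this(2)
  also have "\<dots> = fact n * n ^ n"
    using V by (simp add: card_cartesian_product card_permutations card_PiE)
  also have "\<dots> \<le> n ^ n * n ^ n" using fact_le_power[of n, where ?'a = nat] by simp
  finally have cP: "real (card P) \<le> real n ^ n * real n ^ n"
    by (metis of_nat_le_iff of_nat_mult of_nat_power)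
  have finY: "finite (symmetry_graphs V d \<sigma> \<pi>)" for \<sigma> \<pi>
    by (rule finite_subset[OF _ finite_regular_on[OF V(1), of d]]) (auto simp: symmetry_graphs_def)
  have "?X \<subseteq> (\<Union>(\<sigma>, \<pi>)\<in>P. symmetry_graphs V d \<sigma> \<pi>)"
  proof
    fix E assume E: "E \<in> ?X"
    have "aut_balls1 V E \<noteq> {id}" using E by auto
    then obtain \<sigma> where \<sigma>: "\<sigma> \<in> aut_balls1 V E" "\<sigma> \<noteq> id" using id_in_aut_balls1[of V E] by blast
    have ER: "E \<in> regular_on V d"
     and good: "\<And>u v. u \<in> V \<Longrightarrow> v \<in> V \<Longrightarrow> u \<noteq> v \<Longrightarrow>
       5 * card (insert u (nbh E u) \<inter> insert v (nbh E v)) \<le> 3 * d" using E by blast+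
    have s: "3 * m \<le> card {x \<in> V. \<sigma> x \<noteq> x}"
      by (rule nontrivial_aut_balls1(1)[OF V(1) ER good \<sigma> m])
    have "\<exists>\<pi>\<in>V \<rightarrow>\<^sub>E V. inj_on \<pi> V \<and> E \<in> symmetry_graphs V d \<sigma> \<pi>"
      by (rule nontrivial_aut_balls1(2)[OF V(1) ER good \<sigma> m])
    then obtain \<pi> where \<pi>: "\<pi> \<in> V \<rightarrow>\<^sub>E V" "inj_on \<pi> V" "E \<in> symmetry_graphs V d \<sigma> \<pi>" by blast
    have "\<sigma> permutes V" using \<sigma> by (simp add: aut_balls1_def)
    then have "(\<sigma>, \<pi>) \<in> P" using s \<pi> by (simp add: P_def)
    then show "E \<in> (\<Union>(\<sigma>, \<pi>)\<in>P. symmetry_graphs V d \<sigma> \<pi>)" using \<pi>(3) by blast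
  qed
  then have "card ?X \<le> card (\<Union>(\<sigma>, \<pi>)\<in>P. symmetry_graphs V d \<sigma> \<pi>)"
    by (rule card_mono[rotated]) (use fP finY in auto)
  also have "\<dots> \<le> (\<Sum>(\<sigma>, \<pi>)\<in>P. card (symmetry_graphs V d \<sigma> \<pi>))"
    using card_UN_le[OF fP, of "\<lambda>(\<sigma>, \<pi>). symmetry_graphs V d \<sigma> \<pi>"] by (simp add: case_prod_unfold)
  finally have "real (card ?X) \<le> (\<Sum>(\<sigma>, \<pi>)\<in>P. real (card (symmetry_graphs V d \<sigma> \<pi>)))"
    by (simp add: case_prod_unfold flip: of_nat_sum)
  also have "\<dots> \<le> (\<Sum>(\<sigma>, \<pi>)\<in>P. (1/2) ^ (4 * m * m) * real (card (regular_on V d)))"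
  proof (rule sum_mono, clarify)
    fix \<sigma> \<pi> assume "(\<sigma>, \<pi>) \<in> P"
    then show "real (card (symmetry_graphs V d \<sigma> \<pi>)) \<le> (1/2) ^ (4 * m * m) * real (card (regular_on V d))"
      by (intro symmetry_bound[OF V(1) _ _ _ m]) (auto simp: P_def)
  qed
  also have "\<dots> = real (card P) * ((1/2) ^ (4 * m * m) * real (card (regular_on V d)))"
    by (simp add: case_prod_unfold)
  also have "\<dots> \<le> (real n ^ n * real n ^ n) * ((1/2) ^ (4 * m * m) * real (card (regular_on V d)))"
    by (rule mult_right_mono[OF cP]) simp
  finally show ?thesis by (simp add: mult_ac)
qed

subsection \<open>Existence of regular graphs\<close>

text \<open>Take the \<open>k\<close> smallest and the \<open>k\<close> largest nonzero residues. If
  \<open>d\<close> is odd then \<open>n\<close> is even, and the residue \<open>n div 2\<close>, its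
  own negative, is added.\<close>

lemma symmetric_connection_set:
  fixes n d :: nat
  assumes "even (n * d)" "d < n"
  shows "\<exists>S\<subseteq>{1..<n}. card S = d \<and> (\<forall>s\<in>S. n - s \<in> S)"
proof -
  define k where "k = d div 2"
  have c: "card ({1..k} \<union> {n - k..<n}) = k + k"
    using assms by (subst card_Un_disjoint) (auto simp: k_def)
  have refl: "n - s \<in> {1..k} \<union> {n - k..<n}" if "s \<in> {1..k} \<union> {n - k..<n}" for s
  proof -
    have "2 * k < n" using assms(2) by (simp add: k_def)
    with that show ?thesis by (simp only: Un_iff atLeastAtMost_iff atLeastLessThan_iff) linarith
  qed
  show ?thesis
  proof (cases "even d")
    case True
    have "{1..k} \<union> {n - k..<n} \<subseteq> {1..<n}" using assms(2) by (auto simp: k_def)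
    moreover have "k + k = d" using True by (auto simp: k_def)
    ultimately show ?thesis using c refl by metis
  next
    case False
    then have n: "n = 2 * (n div 2)" "d = Suc (2 * k)" using assms by (auto simp: k_def)
    then have k: "k < n div 2" "n div 2 < n - k" using assms by linarith+
    then have "card (insert (n div 2) ({1..k} \<union> {n - k..<n})) = d"
      using c n by (subst card_insert_disjoint) auto
    moreover have "n - s \<in> insert (n div 2) ({1..k} \<union> {n - k..<n})"
      if "s \<in> insert (n div 2) ({1..k} \<union> {n - k..<n})" for s
      using that refl n k by auto
    moreover have "insert (n div 2) ({1..k} \<union> {n - k..<n}) \<subseteq> {1..<n}"
      using k n by auto
    ultimately show ?thesis by blast
  qed
qed

text \<open>The circulant graph of a symmetric connection set is an example. Its existence is what
  gives \<open>pmf_of_set\<close> in \<open>random_regular_graph\<close> its meaning.\<close>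

lemma regular_on_nonempty:
  fixes n d :: nat
  assumes "even (n * d)" "d < n"
  shows "regular_on {1..n} d \<noteq> {}"
proof -
  obtain S where S: "S \<subseteq> {1..<n}" "card S = d" "\<And>s. s \<in> S \<Longrightarrow> n - s \<in> S"
    using symmetric_connection_set[OF assms] by blast
  define N where "N x = {y \<in> {1..n}. x \<in> {1..n} \<and> (x < y \<and> y - x \<in> S \<or> y < x \<and> x - y \<in> S)}" for x
  have s: "simple_graph {1..n} (graph_of N)"
    by (rule simple_graph_of) (auto simp: N_def)
  have nb: "nbh (graph_of N) x = N x" for x
    by (rule nbh_graph_of) (auto simp: N_def)
  have "card (N x) = d" if x: "x \<in> {1..n}" for x
  proof -
    \<comment> \<open>\<open>?f\<close> is \<open>y - x\<close> modulo \<open>n\<close>, represented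
      in \<open>{1..<n}\<close>, and \<open>?g\<close> is \<open>x + s\<close> modulo
      \<open>n\<close>, represented in \<open>{1..n}\<close>.\<close>
    let ?f = "\<lambda>y. if x < y then y - x else n - (x - y)"
    let ?g = "\<lambda>s. if x + s \<le> n then x + s else x + s - n"
    have "bij_betw ?f (N x) S"
    proof (rule bij_betw_byWitness[where f' = ?g])
      show "\<forall>y\<in>N x. ?g (?f y) = y" using x by (auto simp: N_def)
      show "\<forall>s\<in>S. ?f (?g s) = s" using x S(1) by auto
      show "?f ` N x \<subseteq> S" using S(3) by (fastforce simp: N_def)
      show "?g ` S \<subseteq> N x"
      proof (clarify)
        fix s assume s: "s \<in> S"
        then have "1 \<le> s" "s < n" "n - s \<in> S" using S by auto
        moreover have "x - (x + s - n) = n - s" if "\<not> x + s \<le> n" using that x \<open>s < n\<close> by auto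
        ultimately show "?g s \<in> N x" using x s by (auto simp: N_def)
      qed
    qed
    then show ?thesis using bij_betw_same_card S(2) by blast
  qed
  then have "graph_of N \<in> regular_on {1..n} d" using s nb by (simp add: regular_on_def)
  then show ?thesis by blast
qed

subsection \<open>Asymptotics\<close>

text \<open>Meant for \<open>L = ln n\<close> and \<open>M = d\<^sup>2 / n\<close>, with
  \<open>C\<close> a codegree and \<open>Y\<close> the size of the intersection of the two balls. As
  \<open>x\<^sup>2 = 1 / L\<close>, the additive error \<open>L / x\<close> equals
  \<open>L\<^sup>2 * x\<close>, which is at most \<open>x * M\<close>; all errors, constants
  included, are thus multiples of \<open>x * M\<close>.\<close>

lemma codegree_concentration:
  fixes L M x \<mu> C Y s :: real
  assumes L: "L \<ge> 1" and x: "x = 1 / sqrt L" "x \<le> 1 / 2" and M: "L\<^sup>2 \<le> M"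
    and \<mu>: "\<bar>\<mu> - M\<bar> \<le> 1" and s: "s = 5 * L / x + 1" and C: "C \<le> Y" "Y \<le> C + 2"
    and up: "(1 - x) * C \<le> (1 + x) * \<mu> + s" and low: "(1 - x) * \<mu> - s \<le> (1 + x) * C"
  shows "\<bar>Y - M\<bar> \<le> 21 * x * M"
proof -
  have x0: "x > 0" using L x by simp
  have "L * (x * x) = 1" using L x(1) by simp
  then have "L / x = L\<^sup>2 * x"
    using x0 by (simp add: power2_eq_square divide_eq_eq mult.assoc)
  also have "\<dots> \<le> M * x" using M x0 by (intro mult_right_mono) auto
  finally have Lx: "L / x \<le> x * M" by (simp add: mult.commute)
  have "1 \<le> L / x" using L x(2) x0 by (simp add: field_simps)
  then have one: "1 \<le> x * M" using Lx by linarith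
  define z where "z = x * M"
  have z0: "z > 0" using one by (simp add: z_def)
  have z: "z > 0" "x * z \<le> z / 2" "x * z \<ge> 0"
    using z0 x0 mult_right_mono[OF x(2), of z] by simp_all
  have s': "s \<le> 6 * z" using s Lx one by (simp add: z_def)
  have m: "\<mu> \<le> M + z" "M - z \<le> \<mu>" using \<mu> one by (auto simp: z_def abs_le_iff)
  have "(1 + x) * \<mu> \<le> (1 + x) * (M + z)" using m x0 by (intro mult_left_mono) auto
  then have "(1 - x) * (C - M) \<le> 9 * z + x * z"
    using up s' by (simp add: z_def algebra_simps)
  also have "\<dots> \<le> (1 / 2) * (19 * z)" using z by simp
  finally have u: "(1 - x) * (C - M) \<le> (1 / 2) * (19 * z)" .
  \<comment> \<open>Division by \<open>1 - x \<ge> 1 / 2\<close> at most doubles the bound. The 2 in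
    \<open>Y \<le> C + 2\<close> later raises 19 to 21.\<close>
  have CM: "C - M \<le> 19 * z"
  proof (rule ccontr)
    assume "\<not> ?thesis"
    then have "19 * z < C - M" by simp
    then have "(1 / 2) * (19 * z) < (1 / 2) * (C - M)" by simp
    also have "\<dots> \<le> (1 - x) * (C - M)" using x(2) \<open>19 * z < C - M\<close> z by (intro mult_right_mono) auto
    finally show False using u by simp
  qed
  have "(1 - x) * (M - z) \<le> (1 - x) * \<mu>" using m x by (intro mult_left_mono) auto
  then have l: "- (9 * z) \<le> (1 + x) * (C - M)"
    using low s' z by (simp add: z_def algebra_simps)
  have MC: "- (9 * z) \<le> C - M"
  proof (rule ccontr)
    assume "\<not> ?thesis"
    then have lt: "C - M < - (9 * z)" by simp
    then have "x * (C - M) \<le> 0" using x0 z by (simp add: mult_nonneg_nonpos)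
    then show False using l lt by (simp add: algebra_simps)
  qed
  have "1 \<le> z" using one by (simp add: z_def)
  then have "\<bar>Y - M\<bar> \<le> 21 * z" using CM MC C by (simp add: abs_le_iff)
  then show ?thesis by (simp add: z_def)
qed

section \<open>Union bounds and the resulting probability\<close>

lemma card_closed_nbh_Int:
  assumes "finite (nbh E u)" "finite (nbh E v)" "u \<noteq> v"
  shows "card (nbh E u \<inter> nbh E v) \<le> card (insert u (nbh E u) \<inter> insert v (nbh E v))"
    and "card (insert u (nbh E u) \<inter> insert v (nbh E v)) \<le> card (nbh E u \<inter> nbh E v) + 2"
proof -
  show "card (nbh E u \<inter> nbh E v) \<le> card (insert u (nbh E u) \<inter> insert v (nbh E v))"
    by (rule card_mono) (use assms in auto)
  have "card (insert u (nbh E u) \<inter> insert v (nbh E v)) \<le> card (insert u (insert v (nbh E u \<inter> nbh E v)))"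
    by (rule card_mono) (use assms in auto)
  also have "\<dots> \<le> card (nbh E u \<inter> nbh E v) + 2"
    using assms by (simp add: card_insert_if)
  finally show "card (insert u (nbh E u) \<inter> insert v (nbh E v)) \<le> card (nbh E u \<inter> nbh E v) + 2" .
qed

text \<open>A union bound over at most \<open>n ^ 3\<close> triples. They are ordered, so both signs
  of the difference are covered.\<close>

lemma codegree_difference_bound:
  fixes x t :: real
  assumes V: "finite V" "card V = n" and x: "0 \<le> x" "x \<le> 1"
  shows "real (card {E \<in> regular_on V d. \<exists>w\<in>V. \<exists>w'\<in>V. \<exists>z\<in>V. w \<noteq> w' \<and> z \<noteq> w \<and> z \<noteq> w' \<and>
      x\<^sup>2 * (real (card (nbh E w \<inter> nbh E z)) + real (card (nbh E w' \<inter> nbh E z))) + t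
       < x * (real (card (nbh E w \<inter> nbh E z)) - real (card (nbh E w' \<inter> nbh E z)) - 1)})
     \<le> real n ^ 3 * (2 * real n * exp (- t) * real (card (regular_on V d)))"
    (is "real (card ?X) \<le> _")
proof -
  define Y where "Y = (\<lambda>(w, w', z). {E \<in> regular_on V d.
      x\<^sup>2 * (real (card (nbh E w \<inter> nbh E z)) + real (card (nbh E w' \<inter> nbh E z))) + t
       < x * (real (card (nbh E w \<inter> nbh E z)) - real (card (nbh E w' \<inter> nbh E z)) - 1)})"
  define T where "T = {(w, w', z). w \<in> V \<and> w' \<in> V \<and> z \<in> V \<and> w \<noteq> w' \<and> z \<noteq> w \<and> z \<noteq> w'}"
  have TV: "T \<subseteq> V \<times> V \<times> V" by (auto simp: T_def)
  have fT: "finite T" by (rule finite_subset[OF TV]) (use V in auto)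
  have "card T \<le> card (V \<times> V \<times> V)" by (rule card_mono[OF _ TV]) (use V in auto)
  also have "\<dots> = n ^ 3" using V by (simp add: card_cartesian_product power3_eq_cube)
  finally have cT: "real (card T) \<le> real n ^ 3" by (metis of_nat_le_iff of_nat_power)
  have fY: "finite (Y p)" for p
    by (rule finite_subset[OF _ finite_regular_on[OF V(1), of d]]) (auto simp: Y_def)
  have "?X = (\<Union>p\<in>T. Y p)" unfolding Y_def T_def by blast
  then have "card ?X \<le> (\<Sum>p\<in>T. card (Y p))" using card_UN_le[OF fT] by simp
  then have "real (card ?X) \<le> (\<Sum>p\<in>T. real (card (Y p)))" by (simp flip: of_nat_sum)
  also have "\<dots> \<le> (\<Sum>p\<in>T. 2 * real n * exp (- t) * real (card (regular_on V d)))"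
  proof (rule sum_mono)
    fix p assume "p \<in> T"
    then obtain w w' z where p: "p = (w, w', z)" "w \<in> V" "w' \<in> V" "w \<noteq> w'" "z \<noteq> w" "z \<noteq> w'"
      by (auto simp: T_def)
    show "real (card (Y p)) \<le> 2 * real n * exp (- t) * real (card (regular_on V d))"
      unfolding p(1) Y_def prod.case by (rule codegree_trade_bound[OF V p(2-) x])
  qed
  also have "\<dots> = real (card T) * (2 * real n * exp (- t) * real (card (regular_on V d)))" by simp
  also have "\<dots> \<le> real n ^ 3 * (2 * real n * exp (- t) * real (card (regular_on V d)))"
    by (rule mult_right_mono[OF cT]) simp
  finally show ?thesis .
qed

text \<open>Outside \<open>X1\<close> all ball intersections are concentrated, hence at most
  \<open>6 / 5 * M \<le> 3 / 5 * d\<close> because \<open>d \<le> n / 2\<close>. This is the side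
  condition in \<open>X2\<close>, so a graph outside both events also has the trivial symmetry
  only.\<close>

lemma prob_codegrees_and_rigidity:
  fixes n d :: nat
  defines "x \<equiv> 1 / sqrt (ln (real n))"
  assumes d: "sqrt (real n) * ln (real n) \<le> real d" "real d \<le> real n / 2" "even (n * d)"
    and n: "n \<ge> 3" "21 * x \<le> 1 / 5"
  shows "1 - 2 / real n - real n ^ n * real n ^ n * (1/2) ^ (4 * (d div 20) * (d div 20))
    \<le> measure_pmf.prob (random_regular_graph n d)
      {E. card (aut_balls1 {1..n} E) = 1 \<and>
         (\<forall>u\<in>{1..n}. \<forall>v\<in>{1..n}. u \<noteq> v \<longrightarrow>
           \<bar>real (card (ball1 {1..n} E u \<inter> ball1 {1..n} E v)) - (real d)\<^sup>2 / real n\<bar>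
            \<le> 21 * x * ((real d)\<^sup>2 / real n))}"
    (is "_ \<le> measure_pmf.prob _ ?G")
proof -
  define L where "L = ln (real n)"
  define M where "M = (real d)\<^sup>2 / real n"
  define V where "V = {1..n}"
  define R where "R = regular_on V d"
  have V: "finite V" "card V = n" "n \<ge> 2" using n by (auto simp: V_def)
  have "exp 1 \<le> real n" using exp_le n(1) by simp
  then have L1: "L \<ge> 1" unfolding L_def using n(1) by (subst ln_ge_iff) auto
  have x1: "x = 1 / sqrt L" by (simp add: x_def L_def)
  have "x \<le> 1 / 2" using n(2) by linarith
  moreover have "x > 0" using L1 by (simp add: x1)
  ultimately have x: "x = 1 / sqrt L" "x > 0" "x \<le> 1 / 2" using x1 by simp_all
  have dn: "d < n" "real d \<le> real n" using d(2) n(1) by auto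
  have sq: "sqrt (real n) \<ge> 1" using n by simp
  have "1 * 1 \<le> sqrt (real n) * L" by (rule mult_mono) (use sq L1 in auto)
  then have d1: "d \<ge> 1" using d(1) unfolding L_def by simp
  have "(sqrt (real n) * L)\<^sup>2 \<le> (real d)\<^sup>2"
    by (rule power_mono) (use d(1) L1 in \<open>auto simp: L_def\<close>)
  then have LM: "L\<^sup>2 \<le> M" using n(1) by (simp add: M_def power_mult_distrib field_simps)
  have fR: "finite R" and neR: "R \<noteq> {}"
    unfolding R_def using finite_regular_on[OF V(1)] regular_on_nonempty[OF d(3) dn(1)] by (auto simp: V_def)
  then have cR: "card R > 0" by (simp add: card_gt_0_iff)
  \<comment> \<open>This makes \<open>exp (- t)\<close> equal to \<open>1 / n ^ 5\<close>, which
    against \<open>n ^ 3\<close> triples and the factor \<open>2 * n\<close> leaves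
    \<open>2 / n\<close>.\<close>
  define t where "t = 5 * L"
  define X1 where "X1 = {E \<in> R. \<exists>w\<in>V. \<exists>w'\<in>V. \<exists>z\<in>V. w \<noteq> w' \<and> z \<noteq> w \<and> z \<noteq> w' \<and>
      x\<^sup>2 * (real (card (nbh E w \<inter> nbh E z)) + real (card (nbh E w' \<inter> nbh E z))) + t
       < x * (real (card (nbh E w \<inter> nbh E z)) - real (card (nbh E w' \<inter> nbh E z)) - 1)}"
  define X2 where "X2 = {E \<in> R. card (aut_balls1 V E) \<noteq> 1 \<and>
      (\<forall>u\<in>V. \<forall>v\<in>V. u \<noteq> v \<longrightarrow> 5 * card (insert u (nbh E u) \<inter> insert v (nbh E v)) \<le> 3 * d)}"
  have "real (card X1) \<le> real n ^ 3 * (2 * real n * exp (- t) * real (card R))"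
    unfolding X1_def R_def by (rule codegree_difference_bound[OF V(1,2)]) (use x(2,3) in simp_all)
  also have "exp (- t) = 1 / real n ^ 5"
  proof -
    have "exp t = exp L ^ 5" by (simp add: t_def exp_of_nat_mult[symmetric])
    then show ?thesis using n(1) by (simp add: exp_minus L_def inverse_eq_divide)
  qed
  finally have X1: "real (card X1) \<le> 2 / real n * real (card R)"
    using n(1) by (simp add: field_simps eval_nat_numeral)
  have X2: "real (card X2) \<le> real n ^ n * real n ^ n * (1/2) ^ (4 * (d div 20) * (d div 20)) * real (card R)"
    unfolding X2_def R_def by (rule nontrivial_symmetry_bound[OF V(1,2)]) simp
  have "R - (X1 \<union> X2) \<subseteq> R \<inter> ?G"
  proof
    fix E assume E: "E \<in> R - (X1 \<union> X2)"
    then have ER: "E \<in> regular_on V d" by (simp add: R_def)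
    then have sE: "simple_graph V E" by (simp add: regular_on_def)
    have fin: "finite (nbh E x)" for x using nbh_subset[OF sE] V(1) finite_subset by metis
    \<comment> \<open>The term \<open>t / x\<close> comes from dividing the Chernoff inequality by
      \<open>x\<close>, and the 1 from the exceptional vertex \<open>w'\<close>.\<close>
    define s where "s = 5 * L / x + 1"
    have s0: "s \<ge> 0" using L1 x by (simp add: s_def)
    have close: "real (card (nbh E w \<inter> nbh E z)) - real (card (nbh E w' \<inter> nbh E z))
        \<le> x * (real (card (nbh E w \<inter> nbh E z)) + real (card (nbh E w' \<inter> nbh E z))) + s"
      if w: "w \<in> V" "w' \<in> V" "z \<in> V" "w \<noteq> w'" "z \<noteq> w" "z \<noteq> w'" for w w' z
    proof -
      define a where "a = real (card (nbh E w \<inter> nbh E z))"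
      define b where "b = real (card (nbh E w' \<inter> nbh E z))"
      have "E \<notin> X1" "E \<in> R" using E by auto
      then have "\<not> x\<^sup>2 * (a + b) + t < x * (a - b - 1)"
        unfolding X1_def a_def b_def using w by blast
      then have "x * (a - b - 1) \<le> x\<^sup>2 * (a + b) + t" by (simp only: not_less)
      also have "\<dots> = x * (x * (a + b) + t / x)"
        using x(2) by (simp add: power2_eq_square algebra_simps)
      finally have "a - b - 1 \<le> x * (a + b) + t / x" using x(2) by simp
      then show ?thesis by (simp add: a_def b_def s_def t_def)
    qed
    have conc: "\<bar>real (card (insert u (nbh E u) \<inter> insert v (nbh E v))) - M\<bar> \<le> 21 * x * M"
      if uv: "u \<in> V" "v \<in> V" "u \<noteq> v" for u v
    proof -
      define \<mu> where "\<mu> = real (d * (d - 1)) / (real n - 1)"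
      have n0: "real n > 1" using n(1) by simp
      have "M - \<mu> = (real d * (real n - real d)) / (real n * (real n - 1))"
        using n0 d1 by (simp add: M_def \<mu>_def field_simps power2_eq_square of_nat_diff)
      moreover have "real d * (real n - real d) \<le> real n * (real n - 1)"
        by (rule mult_mono) (use dn d1 n0 in auto)
      moreover have "0 \<le> real d * (real n - real d)" using dn by simp
      moreover have "0 < real n * (real n - 1)" using n0 by simp
      ultimately have "0 \<le> M - \<mu>" "M - \<mu> \<le> 1" by (simp_all add: divide_le_eq_1)
      then have \<mu>: "\<bar>\<mu> - M\<bar> \<le> 1" by linarith
      note est = codegree_estimate[OF V ER less_imp_le[OF x(2)] s0 close uv(1,2,3), folded \<mu>_def]
      note cc = card_closed_nbh_Int[OF fin fin uv(3)]
      show ?thesis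
        by (rule codegree_concentration[OF L1 x(1,3) LM \<mu> s_def _ _ est]) (use cc in linarith)+
    qed
    have M0: "M \<ge> 0" by (simp add: M_def)
    have "real d * real d \<le> real d * (real n / 2)" using d(2) by (intro mult_left_mono) auto
    then have Md: "M \<le> real d / 2" using n(1) by (simp add: M_def power2_eq_square field_simps)
    have "5 * card (insert u (nbh E u) \<inter> insert v (nbh E v)) \<le> 3 * d"
      if uv: "u \<in> V" "v \<in> V" "u \<noteq> v" for u v
    proof -
      have "21 * x * M \<le> 1 / 5 * M" using n(2) M0 by (rule mult_right_mono)
      then have "real (card (insert u (nbh E u) \<inter> insert v (nbh E v))) \<le> 6 / 5 * M"
        using conc[OF uv] by linarith
      also have "\<dots> \<le> 3 / 5 * real d" using Md by simp
      finally show ?thesis by linarith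
    qed
    then have "card (aut_balls1 V E) = 1" using E by (auto simp: X2_def)
    moreover have "\<bar>real (card (ball1 V E u \<inter> ball1 V E v)) - M\<bar> \<le> 21 * x * M"
      if "u \<in> V" "v \<in> V" "u \<noteq> v" for u v
      using conc[OF that] ball1_eq[OF sE] that by simp
    ultimately show "E \<in> R \<inter> ?G" using E unfolding V_def[symmetric] M_def[symmetric] by simp
  qed
  then have "card (R - (X1 \<union> X2)) \<le> card (R \<inter> ?G)" using fR by (intro card_mono) auto
  moreover have "card R - card (X1 \<union> X2) \<le> card (R - (X1 \<union> X2))"
    by (rule diff_card_le_card_Diff) (use fR in \<open>auto simp: X1_def X2_def\<close>)
  moreover have "card (X1 \<union> X2) \<le> card X1 + card X2" by (rule card_Un_le)
  ultimately have "real (card R) - real (card X1) - real (card X2) \<le> real (card (R \<inter> ?G))" by linarith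
  then have "(1 - 2 / real n - real n ^ n * real n ^ n * (1/2) ^ (4 * (d div 20) * (d div 20))) * real (card R)
     \<le> real (card (R \<inter> ?G))"
    using X1 X2 by (simp only: left_diff_distrib)
  then have "1 - 2 / real n - real n ^ n * real n ^ n * (1/2) ^ (4 * (d div 20) * (d div 20))
     \<le> real (card (R \<inter> ?G)) / real (card R)"
    using cR by (simp add: le_divide_eq)
  also have "\<dots> = measure_pmf.prob (random_regular_graph n d) ?G"
    unfolding random_regular_graph_def regular_graphs_eq V_def[symmetric] R_def[symmetric]
    by (rule measure_pmf_of_set[OF neR fR, symmetric])
  finally show ?thesis .
qed

text \<open>Rounding in \<open>d div 20\<close> loses at most a factor two, so
  \<open>m \<ge> d / 40\<close> and \<open>4 * m\<^sup>2 * ln 2\<close> is at least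
  \<open>4 * (n * L\<^sup>2 / 1600) * (2 / 3) = n * L\<^sup>2 / 600\<close>.\<close>

lemma symmetry_union_bound_le:
  fixes n d :: nat
  assumes d: "sqrt (real n) * ln (real n) \<le> real d" "40 \<le> d" and n: "n \<ge> 3"
  shows "real n ^ n * real n ^ n * (1/2) ^ (4 * (d div 20) * (d div 20))
     \<le> exp (real n * ln (real n) * (2 - ln (real n) / 600))"
proof -
  define m where "m = d div 20"
  define L where "L = ln (real n)"
  have L: "L > 0" using n by (simp add: L_def)
  have "real d / 40 \<le> real m" using d(2) by (simp add: m_def)
  then have "sqrt (real n) * L / 40 \<le> real m" using d(1) by (simp add: L_def)
  then have "(sqrt (real n) * L / 40)\<^sup>2 \<le> (real m)\<^sup>2" using L by (intro power_mono) auto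
  moreover have "(sqrt (real n) * L / 40)\<^sup>2 = real n * L\<^sup>2 / 1600"
    by (simp add: power_mult_distrib power_divide)
  ultimately have m2: "real n * L\<^sup>2 / 1600 \<le> real m * real m"
    by (simp add: power2_eq_square[of "real m"])
  have "real n ^ n = exp (real n * L)" using n by (simp add: L_def exp_of_nat_mult)
  moreover have "(1/2 :: real) ^ (4 * m * m) = exp (- (real (4 * m * m) * ln 2))"
    by (simp add: exp_minus exp_of_nat_mult power_one_over inverse_eq_divide del: of_nat_mult)
  ultimately have "real n ^ n * real n ^ n * (1/2) ^ (4 * m * m)
     = exp (2 * real n * L - real (4 * m * m) * ln 2)"
    by (simp add: exp_add[symmetric])
  also have "\<dots> \<le> exp (real n * L * (2 - L / 600))"
  proof -
    have "real n * L\<^sup>2 / 600 = 4 * (real n * L\<^sup>2 / 1600) * (2/3)" by simp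
    also have "\<dots> \<le> 4 * (real m * real m) * ln 2"
      by (rule mult_mono) (use m2 ln2_ge_two_thirds in auto)
    finally show ?thesis by (simp add: algebra_simps power2_eq_square)
  qed
  finally show ?thesis by (simp add: m_def L_def)
qed

theorem theorem6:
  fixes d :: "nat \<Rightarrow> nat"
  assumes "\<forall>\<^sub>F n in sequentially.
             sqrt (real n) * ln (real n) \<le> real (d n) \<and> real (d n) \<le> real n / 2 \<and> even (n * d n)"
  shows "\<exists>\<epsilon> :: nat \<Rightarrow> real. \<epsilon> \<longlonglongrightarrow> 0 \<and>
           (\<lambda>n. measure_pmf.prob (random_regular_graph n (d n))
                  {E. card (aut_balls1 {1..n} E) = 1 \<and>
                      (\<forall>u\<in>{1..n}. \<forall>v\<in>{1..n}. u \<noteq> v \<longrightarrow>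
                         \<bar>real (card (ball1 {1..n} E u \<inter> ball1 {1..n} E v)) - (real (d n))\<^sup>2 / real n\<bar>
                           \<le> \<epsilon> n * ((real (d n))\<^sup>2 / real n))})
           \<longlonglongrightarrow> 1"
proof -
  define \<epsilon> where "\<epsilon> n = 21 * (1 / sqrt (ln (real n)))" for n :: nat
  define p where "p n = measure_pmf.prob (random_regular_graph n (d n))
                  {E. card (aut_balls1 {1..n} E) = 1 \<and>
                      (\<forall>u\<in>{1..n}. \<forall>v\<in>{1..n}. u \<noteq> v \<longrightarrow>
                         \<bar>real (card (ball1 {1..n} E u \<inter> ball1 {1..n} E v)) - (real (d n))\<^sup>2 / real n\<bar>
                           \<le> \<epsilon> n * ((real (d n))\<^sup>2 / real n))}" for n
  \<comment> \<open>The exponent is negative once \<open>ln n\<close> exceeds 1200, and it tends to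
    minus infinity.\<close>
  define q where "q n = 1 - 2 / real n - exp (real n * ln (real n) * (2 - ln (real n) / 600))" for n :: nat
  have \<epsilon>: "\<epsilon> \<longlonglongrightarrow> 0" unfolding \<epsilon>_def by real_asymp
  have q: "q \<longlonglongrightarrow> 1" unfolding q_def by real_asymp
  have ev: "\<forall>\<^sub>F n in sequentially. \<epsilon> n \<le> 1 / 5"
    using order_tendstoD(2)[OF \<epsilon>, of "1 / 5"] by (simp add: eventually_mono less_imp_le)
  have ev2: "\<forall>\<^sub>F n in sequentially. 40 \<le> sqrt (real n) * ln (real n)" by real_asymp
  have "\<forall>\<^sub>F n in sequentially. q n \<le> p n"
    using assms ev ev2 eventually_ge_at_top[of 3]
  proof eventually_elim
    case (elim n)
    have "40 \<le> d n" using elim by linarith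
    then have "real n ^ n * real n ^ n * (1/2) ^ (4 * (d n div 20) * (d n div 20))
     \<le> exp (real n * ln (real n) * (2 - ln (real n) / 600))"
      using elim by (intro symmetry_union_bound_le) auto
    moreover have "1 - 2 / real n - real n ^ n * real n ^ n * (1/2) ^ (4 * (d n div 20) * (d n div 20)) \<le> p n"
      unfolding p_def \<epsilon>_def
      by (rule prob_codegrees_and_rigidity) (use elim in \<open>auto simp: \<epsilon>_def\<close>)
    ultimately show ?case unfolding q_def by linarith
  qed
  moreover have "\<forall>\<^sub>F n in sequentially. p n \<le> 1" by (simp add: p_def)
  ultimately have "p \<longlonglongrightarrow> 1"
    by (intro tendsto_sandwich[OF _ _ q tendsto_const]) auto
  then show ?thesis using \<epsilon> unfolding p_def by blast
qed

end
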